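(* $\displaystyle\lim_{H\to\infty}\frac{D^*_3(H)}{H^2\log H}=\frac{96}{\pi^2}$.
   Context: A polynomial $f\in\mathbb{C}[X]$ is degenerate if it has two distinct roots whose quotient is a root of unity. $D^*_3(H)$ is the number of polynomials $a_0X^3+a_1X^2+a_2X+a_3\in\mathbb{Z}[X]$ with $a_0\ne 0$, degenerate, and $|a_j|\le H$ for $j=0,1,2,3$; $H$ runs over positive integers. *)

theory Defs
  imports Complex_Main "HOL-Computational_Algebra.Polynomial"
begin

definition root_of_unity :: "complex \<Rightarrow> bool" where
  "root_of_unity z \<longleftrightarrow> (\<exists>k::nat. k > 0 \<and> z ^ k = 1)"

text \<open>If one of the two roots is zero, the quotient is zero under the convention
  \<open>x / 0 = 0\<close> (or as a genuine quotient), which is not a root of unity; so a root zero never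
  contributes to degeneracy.\<close>

definition degenerate :: "complex poly \<Rightarrow> bool" where
  "degenerate f \<longleftrightarrow>
     (\<exists>\<alpha> \<beta>. poly f \<alpha> = 0 \<and> poly f \<beta> = 0 \<and> \<alpha> \<noteq> \<beta> \<and> root_of_unity (\<alpha> / \<beta>))"

definition degenerate_cubics :: "nat \<Rightarrow> int poly set" where
  "degenerate_cubics H =
     {f. degree f = 3 \<and> (\<forall>j\<le>3. \<bar>coeff f j\<bar> \<le> int H) \<and> degenerate (map_poly of_int f)}"

definition D3_star :: "nat \<Rightarrow> nat" where
  "D3_star H = card (degenerate_cubics H)"

text \<open>The set counted is finite, so \<^const>\<open>card\<close> has its intended meaning.\<close>

lemma finite_degenerate_cubics: "finite (degenerate_cubics H)"
proof (rule finite_subset)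
  let ?I = "{- int H..int H}"
  show "degenerate_cubics H \<subseteq> (\<lambda>(a, b, c, d). [:a, b, c, d:]) ` (?I \<times> ?I \<times> ?I \<times> ?I)"
  proof
    fix f assume f: "f \<in> degenerate_cubics H"
    have "f = [:coeff f 0, coeff f 1, coeff f 2, coeff f 3:]"
      using f by (intro poly_eqI)
        (auto simp: degenerate_cubics_def coeff_pCons numeral_2_eq_2 numeral_3_eq_3
          coeff_eq_0 split: nat.splits)
    moreover have "coeff f j \<in> ?I" if "j \<le> 3" for j
      using f that by (auto simp: degenerate_cubics_def abs_le_iff)
    ultimately show "f \<in> (\<lambda>(a, b, c, d). [:a, b, c, d:]) ` (?I \<times> ?I \<times> ?I \<times> ?I)"
      by (intro image_eqI[of _ _ "(coeff f 0, coeff f 1, coeff f 2, coeff f 3)"]) auto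
  qed
qed simp

end

(* A degenerate cubic a X^3 + b X^2 + c X + d either has roots alpha, -alpha with alpha nonzero,
   which means a d = b c and c nonzero, or has b = c = 0, or splits as a rational linear factor
   times a quadratic p X^2 + q X + r with q^2 = k p r and k in {1, 2, 3}. The last two kinds
   contribute only O(H^2). The quadruples with a d = b c are, up to 8 sign choices and O(H^2)
   quadruples with zeros, of the form (x s, y s, x t, y t) with coprime positive x, y; so their number
   is 8 times the sum of (H div max x y)^2 over such x, y. With c(n) coprime pairs of maximum n, the
   identity sum_{d | n} c(d) = 2 n - 1 yields sum_{n <= N} c(n) / n^2 ~ (2 / zeta(2)) ln N. *)
theory Submission
  imports Defs "HOL-Computational_Algebra.Nth_Powers" "HOL-Analysis.Gamma_Function"
    "HOL-Real_Asymp.Real_Asymp"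
begin

section \<open>Classification of degenerate cubics\<close>

text \<open>The order of the root of unity is not bounded in advance. What controls it is a rational
  third root: then \<alpha>/\<beta> + \<beta>/\<alpha> is rational, hence an integer in [-2, 2]. The
  value 2 would force \<alpha> = \<beta>, the value -2 is \<alpha> = -\<beta>, and the remaining
  values -1, 0, 1 (orders 3, 4, 6) are k - 2. The only degenerate cubics for which no rational root
  is forced are a X^3 + d. Only the first kind produces a logarithm. There the ratios of height n
  number a constant times n on average and leave about (H/n)^2 choices each, which sums like 1/n. In
  the split kind the quadratics with q^2 = k p r are so sparse that the corresponding sum converges.
  Since the normalisation is H^2 log H, every error is needed only up to O(H^2), and all secondary
  constants are crude.\<close>

text \<open>Gauss's lemma by synthetic division: the conclusion compares coefficients in (v X - u)(p
  X^2 + q X + r). At each stage all terms but one are visibly divisible by \<open>v\<close>, and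
  coprimality with \<open>u\<close> moves the factor \<open>v\<close> into the current leading
  coefficient.\<close>

lemma rational_root_factor:
  fixes a b c d u v :: int
  assumes "coprime u v" "v \<noteq> 0" "a * u ^ 3 + b * u ^ 2 * v + c * u * v ^ 2 + d * v ^ 3 = 0"
  shows "\<exists>p q r. a = v * p \<and> b = v * q - u * p \<and> c = v * r - u * q \<and> d = - u * r"
proof -
  have cop: "coprime v (u ^ n)" for n
    using assms(1) by (simp add: coprime_commute)
  have "v dvd a * u ^ 3"
  proof -
    have "a * u ^ 3 = v * (- b * u ^ 2 - c * u * v - d * v ^ 2)"
      using assms(3) by (simp add: algebra_simps power2_eq_square power3_eq_cube)
    then show ?thesis by simp
  qed
  then have "v dvd a"
    using cop coprime_dvd_mult_left_iff by blast
  then obtain p where p: "a = v * p" ..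
  have "v * (p * u ^ 3 + b * u ^ 2 + c * u * v + d * v ^ 2) = 0"
    using assms(3) p by (simp add: algebra_simps power2_eq_square power3_eq_cube)
  then have eq2: "p * u ^ 3 + b * u ^ 2 + c * u * v + d * v ^ 2 = 0"
    using assms(2) by simp
  then have "(p * u + b) * u ^ 2 = v * (- c * u - d * v)"
    by (simp add: algebra_simps power2_eq_square power3_eq_cube)
  then have "v dvd (p * u + b) * u ^ 2" by simp
  then have "v dvd p * u + b"
    using cop coprime_dvd_mult_left_iff by blast
  then obtain q where q: "p * u + b = v * q" ..
  then have b: "b = v * q - u * p" by (simp add: algebra_simps)
  have "v * (q * u ^ 2 + c * u + d * v) = 0"
    using eq2 b by (simp add: algebra_simps power2_eq_square power3_eq_cube)
  then have eq3: "q * u ^ 2 + c * u + d * v = 0"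
    using assms(2) by simp
  then have "(q * u + c) * u ^ 1 = v * (- d)"
    by (simp add: algebra_simps power2_eq_square)
  then have "v dvd (q * u + c) * u ^ 1" by simp
  then have "v dvd q * u + c"
    using cop coprime_dvd_mult_left_iff by blast
  then obtain r where r: "q * u + c = v * r" ..
  then have c: "c = v * r - u * q" by (simp add: algebra_simps)
  have "v * (r * u + d) = 0"
    using eq3 c by (simp add: algebra_simps power2_eq_square)
  then have "r * u + d = 0" using assms(2) by simp
  then have "d = - u * r" by (simp add: algebra_simps)
  with p b c show ?thesis by blast
qed

text \<open>If \<open>t\<close> had a denominator \<open>D > 1\<close>, the iterates of \<open>t \<mapsto> t\<^sup>2 - 2\<close> would have denominators
  \<open>D\<close>, \<open>D\<^sup>2\<close>, \<open>D\<^sup>4\<close>, \<dots>, whereas they are sums of powers of a root of unity and take finitely many values.\<close>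

lemma rational_root_of_unity_trace_int:
  fixes \<eta> :: complex
  assumes "\<eta> ^ n = 1" "n > 0" "\<eta> + inverse \<eta> \<in> \<rat>"
  shows "\<eta> + inverse \<eta> \<in> \<int>"
proof -
  have nz: "\<eta> \<noteq> 0" using assms by (auto simp: power_0_left)
  obtain x y :: int where xy: "y > 0" "coprime x y" "\<eta> + inverse \<eta> = of_int x / of_int y"
    using assms(3) by (elim Rats_cases') auto
  define t where "t = (\<lambda>k::nat. \<eta> ^ (2 ^ k) + inverse \<eta> ^ (2 ^ k))"
  have power_Suc_2: "x ^ (2 ^ Suc k) = (x ^ 2 ^ k) ^ 2" for x :: "'a :: monoid_mult" and k
    by (simp only: power_mult[symmetric] power_Suc2)
  have t_Suc: "t (Suc k) = (t k) ^ 2 - 2" for k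
  proof -
    have "\<eta> ^ (2 ^ k) * inverse \<eta> ^ (2 ^ k) = 1"
      using nz by (simp only: power_mult_distrib[symmetric]) simp
    moreover have "x ^ 2 + y ^ 2 = (x + y) ^ 2 - 2" if "x * y = 1" for x y :: complex
      using that by algebra
    ultimately show ?thesis unfolding t_def power_Suc_2 by blast
  qed
  have repr: "\<exists>x'. coprime x' y \<and> t k = of_int x' / of_int (y ^ (2 ^ k))" for k
  proof (induction k)
    case 0
    then show ?case using xy by (auto simp: t_def)
  next
    case (Suc k)
    then obtain x' where x': "coprime x' y" "t k = of_int x' / of_int (y ^ (2 ^ k))" by blast
    have "t (Suc k) = of_int (x' ^ 2 - 2 * (y ^ 2 ^ k) ^ 2) / of_int (y ^ (2 ^ Suc k))"
      unfolding t_Suc x'(2) power_Suc_2 using xy(1) by (simp add: power_divide diff_divide_distrib)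
    moreover have "coprime (x' ^ 2 - 2 * (y ^ 2 ^ k) ^ 2) y"
    proof -
      have "y dvd y ^ 2 ^ k" by (rule dvd_power) simp
      then have y_dvd: "y dvd 2 * (y ^ 2 ^ k) ^ 2" by (simp add: power2_eq_square)
      show ?thesis
      proof (rule coprimeI)
        fix e assume "e dvd x' ^ 2 - 2 * (y ^ 2 ^ k) ^ 2" "e dvd y"
        then have "e dvd (x' ^ 2 - 2 * (y ^ 2 ^ k) ^ 2) + 2 * (y ^ 2 ^ k) ^ 2"
          using y_dvd by (intro dvd_add) (auto intro: dvd_trans)
        then have "e dvd x' ^ 2" by (simp only: diff_add_cancel)
        moreover have "coprime (x' ^ 2) y" using x'(1) by simp
        ultimately show "is_unit e" using \<open>e dvd y\<close> coprime_common_divisor[of "x' ^ 2" y e] by simp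
      qed
    qed
    ultimately show ?case by blast
  qed
  have "finite (range (\<lambda>k. \<eta> ^ k))"
  proof (rule finite_subset)
    show "range (\<lambda>k. \<eta> ^ k) \<subseteq> (\<lambda>k. \<eta> ^ k) ` {..<n}"
    proof
      fix z assume "z \<in> range (\<lambda>k. \<eta> ^ k)"
      then obtain k where "z = \<eta> ^ k" by blast
      also have "\<eta> ^ k = (\<eta> ^ n) ^ (k div n) * \<eta> ^ (k mod n)"
        by (simp flip: power_mult power_add)
      also have "\<dots> = \<eta> ^ (k mod n)" using assms(1) by simp
      finally show "z \<in> (\<lambda>k. \<eta> ^ k) ` {..<n}" using assms(2) by auto
    qed
  qed simp
  then have "finite ((\<lambda>z. z + inverse z) ` range (\<lambda>k. \<eta> ^ k))" by simp
  moreover have "range t \<subseteq> (\<lambda>z. z + inverse z) ` range (\<lambda>k. \<eta> ^ k)"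
    by (auto simp: t_def power_inverse)
  ultimately have "finite (range t)" by (rule rev_finite_subset)
  then have "\<not> inj t" using finite_imageD by blast
  then obtain i j where ij: "t i = t j" "i < j"
    unfolding inj_def by (metis linorder_neqE_nat)
  obtain x1 where x1: "coprime x1 y" "t i = of_int x1 / of_int (y ^ (2 ^ i))" using repr by blast
  obtain x2 where x2: "coprime x2 y" "t j = of_int x2 / of_int (y ^ (2 ^ j))" using repr by blast
  have "of_int (x1 * y ^ (2 ^ j)) = (of_int (x2 * y ^ (2 ^ i)) :: complex)"
    using x1(2) x2(2) ij(1) xy(1) by (simp add: field_simps)
  then have e: "x1 * y ^ (2 ^ j) = x2 * y ^ (2 ^ i)" by (simp only: of_int_eq_iff)
  \<comment> \<open>Cancelling the smaller denominator leaves a positive power of \<open>y\<close>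
    dividing \<open>x2\<close>, although \<open>x2\<close> is coprime to \<open>y\<close>.\<close>
  have "(2::nat) ^ j = 2 ^ i + (2 ^ j - 2 ^ i)" using ij(2) by simp
  then have "y ^ (2 ^ j) = y ^ (2 ^ i) * y ^ (2 ^ j - 2 ^ i)" by (metis power_add)
  then have "x1 * y ^ (2 ^ j - 2 ^ i) = x2" using e xy(1) by simp
  moreover have "y dvd y ^ (2 ^ j - 2 ^ i)" using ij(2) by simp
  ultimately have "y dvd x2" by (metis dvd_mult)
  then have "is_unit y" using x2(1) coprime_common_divisor[of x2 y y] by simp
  then have "y = 1" using xy(1) by simp
  then show ?thesis using xy(3) by simp
qed

section \<open>Symmetric functions of the roots and powers modulo the cubic\<close>

text \<open>The third root is defined by Vieta's formula for the sum, and may coincide with \<alpha>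
  or \<beta>. Subtracting the two root equations and cancelling \<alpha> - \<beta> gives the formula
  for \<open>c\<close>; either equation then gives \<open>d\<close>.\<close>

lemma cubic_factor:
  fixes \<alpha> \<beta> a b c d x :: complex
  assumes "a \<noteq> 0" "\<alpha> \<noteq> \<beta>"
    "a * \<alpha> ^ 3 + b * \<alpha> ^ 2 + c * \<alpha> + d = 0" "a * \<beta> ^ 3 + b * \<beta> ^ 2 + c * \<beta> + d = 0"
  defines "\<gamma> \<equiv> - b / a - \<alpha> - \<beta>"
  shows "b = - a * (\<alpha> + \<beta> + \<gamma>)" "c = a * (\<alpha> * \<beta> + \<beta> * \<gamma> + \<gamma> * \<alpha>)" "d = - a * \<alpha> * \<beta> * \<gamma>"
proof -
  show b: "b = - a * (\<alpha> + \<beta> + \<gamma>)"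
    using assms(1) by (simp add: \<gamma>_def field_simps)
  have "(\<alpha> - \<beta>) * (a * (\<alpha> ^ 2 + \<alpha> * \<beta> + \<beta> ^ 2) + b * (\<alpha> + \<beta>) + c) = 0"
    using assms(3,4) by algebra
  then have "a * (\<alpha> ^ 2 + \<alpha> * \<beta> + \<beta> ^ 2) + b * (\<alpha> + \<beta>) + c = 0"
    using assms(2) by simp
  then show c: "c = a * (\<alpha> * \<beta> + \<beta> * \<gamma> + \<gamma> * \<alpha>)"
    unfolding b by algebra
  show "d = - a * \<alpha> * \<beta> * \<gamma>"
    using assms(3) unfolding b c by algebra
qed

text \<open>Remainder of X^n on division by the cubic. The coefficients are chosen before
  \<open>x\<close>, so the same rational triple serves all three roots.\<close>

lemma power_mod_cubic:
  fixes e1 e2 e3 :: complex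
  assumes "e1 \<in> \<rat>" "e2 \<in> \<rat>" "e3 \<in> \<rat>"
  shows "\<exists>A\<in>\<rat>. \<exists>B\<in>\<rat>. \<exists>C\<in>\<rat>. \<forall>x. x ^ 3 = e1 * x ^ 2 - e2 * x + e3 \<longrightarrow> x ^ n = A * x ^ 2 + B * x + C"
proof (induction n)
  case 0
  then show ?case by (intro bexI[of _ 0] bexI[of _ 1]) auto
next
  case (Suc n)
  then obtain A B C where ABC: "A \<in> \<rat>" "B \<in> \<rat>" "C \<in> \<rat>"
    "\<And>x. x ^ 3 = e1 * x ^ 2 - e2 * x + e3 \<Longrightarrow> x ^ n = A * x ^ 2 + B * x + C" by blast
  have "x ^ Suc n = (A * e1 + B) * x ^ 2 + (C - A * e2) * x + A * e3"
    if "x ^ 3 = e1 * x ^ 2 - e2 * x + e3" for x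
  proof -
    have "x ^ Suc n = A * x ^ 3 + B * x ^ 2 + C * x"
      using ABC(4)[OF that] by (simp add: algebra_simps power2_eq_square power3_eq_cube)
    then show ?thesis unfolding that by (simp add: algebra_simps)
  qed
  then show ?case using ABC(1-3) assms by (blast intro: Rats_add Rats_mult Rats_diff)
qed

text \<open>The cubics \<open>(v X - u) (p X\<^sup>2 + q X + r)\<close> whose quadratic factor has roots \<open>\<alpha> \<noteq> \<plusminus>\<beta>\<close> with
  \<open>\<alpha> / \<beta>\<close> a root of unity; here \<open>k = \<alpha>/\<beta> + \<beta>/\<alpha> + 2\<close>.\<close>

definition linear_quadratic_split :: "int \<Rightarrow> int \<Rightarrow> int \<Rightarrow> int \<Rightarrow> bool" where
  "linear_quadratic_split a b c d \<longleftrightarrow>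
    (\<exists>u v p q r k. v \<noteq> 0 \<and> p \<noteq> 0 \<and> r \<noteq> 0 \<and> k \<in> {1, 2, 3} \<and> q ^ 2 = k * p * r \<and>
       a = v * p \<and> b = v * q - u * p \<and> c = v * r - u * q \<and> d = - u * r)"

text \<open>If \<alpha> = -\<beta>, Vieta's formulas give \<open>a * d = b * c\<close> at once.
  Otherwise the factor belonging to \<gamma> is divided out over the integers, and the remaining
  quadratic satisfies q^2 / (p r) = (\<alpha> + \<beta>)^2 / (\<alpha> \<beta>) = \<eta> + 1/\<eta>
  + 2 with \<eta> = \<alpha>/\<beta>. So the trace of \<eta> is rational, hence an integer, and
  strictly between -2 and 2.\<close>

lemma degenerate_pair_cases:
  fixes a b c d :: int and \<alpha> \<beta> \<gamma> :: complex
  assumes "a \<noteq> 0" "\<alpha> \<noteq> \<beta>" "\<alpha> ^ n = \<beta> ^ n" "n > 0" "\<gamma> \<in> \<rat>"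
    and b: "of_int b = - of_int a * (\<alpha> + \<beta> + \<gamma>)"
    and c: "of_int c = of_int a * (\<alpha> * \<beta> + \<beta> * \<gamma> + \<gamma> * \<alpha>)"
    and d: "of_int d = - of_int a * \<alpha> * \<beta> * \<gamma>"
  shows "a * d = b * c \<and> c \<noteq> 0 \<or> linear_quadratic_split a b c d"
proof (cases "\<alpha> = - \<beta>")
  case True
  have "\<beta> \<noteq> 0" using assms(2) True by auto
  have "of_int (a * d) = (of_int (b * c) :: complex)"
    unfolding of_int_mult b c d True by algebra
  moreover have "(of_int c :: complex) \<noteq> 0"
    unfolding c True using assms(1) \<open>\<beta> \<noteq> 0\<close> by (simp add: algebra_simps)
  ultimately show ?thesis by (simp only: of_int_eq_iff of_int_eq_0_iff) simp
next
  case False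
  have nz: "\<alpha> \<noteq> 0" "\<beta> \<noteq> 0"
    using assms(2,3,4) by (auto simp: power_0_left)
  obtain u v :: int where uv: "v > 0" "coprime u v" "\<gamma> = of_int u / of_int v"
    using assms(5) by (elim Rats_cases') auto
  have "of_int (a * u ^ 3 + b * u ^ 2 * v + c * u * v ^ 2 + d * v ^ 3) = (0 :: complex)"
    unfolding of_int_add of_int_mult of_int_power b c d uv(3)
    using uv(1) by (simp add: field_simps power2_eq_square power3_eq_cube)
  then have "a * u ^ 3 + b * u ^ 2 * v + c * u * v ^ 2 + d * v ^ 3 = 0"
    by (simp only: of_int_eq_0_iff)
  with rational_root_factor uv obtain p q r where pqr: "a = v * p" "b = v * q - u * p"
    "c = v * r - u * q" "d = - u * r" by (metis less_irrefl)
  have "p \<noteq> 0" using assms(1) pqr(1) by auto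
  have vne: "(of_int v :: complex) \<noteq> 0" and pne: "(of_int p :: complex) \<noteq> 0"
    using uv(1) \<open>p \<noteq> 0\<close> by auto
  have vg: "of_int u = of_int v * \<gamma>" using uv by simp
  have pqr_complex: "of_int a = of_int v * (of_int p :: complex)"
    "of_int b = of_int v * of_int q - of_int u * (of_int p :: complex)"
    "of_int c = of_int v * of_int r - of_int u * (of_int q :: complex)"
    using pqr by simp_all
  have q: "of_int q = - of_int p * (\<alpha> + \<beta>)"
  proof -
    have "of_int v * of_int q = of_int v * (- of_int p * (\<alpha> + \<beta>))"
      using b pqr_complex(1,2) vg by algebra
    then show ?thesis using vne by (simp only: mult_cancel_left) simp
  qed
  have r: "of_int r = of_int p * (\<alpha> * \<beta>)"
  proof -
    have "of_int v * of_int r = of_int v * (of_int p * (\<alpha> * \<beta>))"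
      using c pqr_complex(1,3) vg q by algebra
    then show ?thesis using vne by (simp only: mult_cancel_left) simp
  qed
  have "r \<noteq> 0" using r pne nz by auto
  define \<eta> where "\<eta> = \<alpha> / \<beta>"
  have eta: "\<eta> + inverse \<eta> = of_int (q ^ 2) / of_int (p * r) - 2"
    unfolding \<eta>_def of_int_power of_int_mult q r using nz pne
    by (simp add: field_simps power2_eq_square)
  have eta1: "\<eta> ^ n = 1" using assms(3) nz by (simp add: \<eta>_def power_divide)
  have "\<eta> + inverse \<eta> \<in> \<rat>" unfolding eta by (intro Rats_diff Rats_divide) simp_all
  from rational_root_of_unity_trace_int[OF eta1 assms(4) this]
  obtain t :: int where t: "\<eta> + inverse \<eta> = of_int t" by (auto elim: Ints_cases)
  have "of_int (q ^ 2) = (of_int ((t + 2) * p * r) :: complex)"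
    using eta pne \<open>r \<noteq> 0\<close> unfolding t by (simp add: field_simps)
  then have qk: "q ^ 2 = (t + 2) * p * r" by (simp only: of_int_eq_iff)
  have n1: "norm \<eta> = 1" using eta1 assms(4) by (metis norm_one norm_power power_eq_1_iff norm_ge_zero less_irrefl)
  have "norm (of_int t :: complex) \<le> norm \<eta> + norm (inverse \<eta>)"
    unfolding t[symmetric] by (rule norm_triangle_ineq)
  then have "\<bar>t\<bar> \<le> 2" using n1 by (simp add: norm_inverse)
  moreover have "t \<noteq> 2"
  proof
    assume "t = 2"
    have "\<eta> * (\<eta> + inverse \<eta>) = 1 + \<eta> * \<eta>"
      using n1 by (cases "\<eta> = 0") (auto simp: distrib_left)
    then have "(\<eta> - 1) ^ 2 = 0"
      unfolding t \<open>t = 2\<close> by (simp add: algebra_simps power2_eq_square)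
    then show False using assms(2) nz by (simp add: \<eta>_def)
  qed
  moreover have "t \<noteq> -2"
  proof
    assume "t = -2"
    then have "q = 0" using qk by simp
    then show False using q pne False by (simp add: eq_neg_iff_add_eq_0)
  qed
  ultimately have "t + 2 \<in> {1, 2, 3}" by auto
  with qk pqr \<open>p \<noteq> 0\<close> \<open>r \<noteq> 0\<close> uv(1) show ?thesis
    unfolding linear_quadratic_split_def by (metis less_irrefl)
qed

text \<open>Reducing \<open>X\<^sup>n\<close> modulo the cubic to \<open>A X\<^sup>2 + B X + C\<close>, the equation \<open>\<alpha>\<^sup>n = \<beta>\<^sup>n\<close> gives
  \<open>A (\<alpha> + \<beta>) + B = 0\<close>. So either \<open>\<alpha> + \<beta>\<close> is rational, or all three roots have the same \<open>n\<close>-th power,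
  hence the same modulus \<open>R\<close>; then \<open>e\<^sub>3 e\<^sub>1 = R\<^sup>2 e\<^sub>2\<close>, and \<open>e\<^sub>2 / e\<^sub>1\<close> is a rational root.\<close>

lemma degenerate_cubic_cases:
  fixes a b c d :: int and \<alpha> \<beta> :: complex
  assumes "a \<noteq> 0" "\<alpha> \<noteq> \<beta>" "root_of_unity (\<alpha> / \<beta>)"
    and \<alpha>: "of_int a * \<alpha> ^ 3 + of_int b * \<alpha> ^ 2 + of_int c * \<alpha> + of_int d = 0"
    and \<beta>: "of_int a * \<beta> ^ 3 + of_int b * \<beta> ^ 2 + of_int c * \<beta> + of_int d = 0"
  shows "a * d = b * c \<and> c \<noteq> 0 \<or> b = 0 \<and> c = 0 \<or> linear_quadratic_split a b c d"
proof -
  obtain n where n: "n > 0" "(\<alpha> / \<beta>) ^ n = 1"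
    using assms(3) by (auto simp: root_of_unity_def)
  then have nz: "\<beta> \<noteq> 0" "\<alpha> \<noteq> 0" by (auto simp: power_0_left)
  have pow: "\<alpha> ^ n = \<beta> ^ n" using n(2) nz by (simp add: power_divide)
  have ane: "(of_int a :: complex) \<noteq> 0" using assms(1) by simp
  define \<gamma> where "\<gamma> = - of_int b / of_int a - \<alpha> - \<beta>"
  note fac = cubic_factor[OF ane assms(2) \<alpha> \<beta>, folded \<gamma>_def]
  define e1 e2 e3 where "e1 = \<alpha> + \<beta> + \<gamma>" and "e2 = \<alpha> * \<beta> + \<beta> * \<gamma> + \<gamma> * \<alpha>" and "e3 = \<alpha> * \<beta> * \<gamma>"
  have e: "e1 = - of_int b / of_int a" "e2 = of_int c / of_int a" "e3 = - of_int d / of_int a"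
  proof -
    have "of_int b = - of_int a * e1" "of_int c = of_int a * e2" "of_int d = - of_int a * e3"
      using fac unfolding e1_def e2_def e3_def by (simp_all only: mult.assoc)
    then show "e1 = - of_int b / of_int a" "e2 = of_int c / of_int a" "e3 = - of_int d / of_int a"
      using ane by simp_all
  qed
  then have rat: "e1 \<in> \<rat>" "e2 \<in> \<rat>" "e3 \<in> \<rat>" by (auto intro!: Rats_divide)
  obtain A B C where ABC: "A \<in> \<rat>" "B \<in> \<rat>" "C \<in> \<rat>"
    "\<And>x. x ^ 3 = e1 * x ^ 2 - e2 * x + e3 \<Longrightarrow> x ^ n = A * x ^ 2 + B * x + C"
    using power_mod_cubic[OF rat] by metis
  have roots: "x ^ 3 = e1 * x ^ 2 - e2 * x + e3" if "x \<in> {\<alpha>, \<beta>, \<gamma>}" for x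
  proof -
    have "(x - \<alpha>) * (x - \<beta>) * (x - \<gamma>) = 0" using that by auto
    then show ?thesis unfolding e1_def e2_def e3_def by algebra
  qed
  have AB: "A * (\<alpha> + \<beta>) + B = 0"
  proof -
    have "(\<alpha> - \<beta>) * (A * (\<alpha> + \<beta>) + B) = 0"
    proof -
      have "\<alpha> ^ n = A * \<alpha> ^ 2 + B * \<alpha> + C" "\<beta> ^ n = A * \<beta> ^ 2 + B * \<beta> + C"
        by (simp_all add: ABC(4) roots)
      then have "A * \<alpha> ^ 2 + B * \<alpha> + C = A * \<beta> ^ 2 + B * \<beta> + C" using pow by simp
      then show ?thesis by algebra
    qed
    then show ?thesis using assms(2) by simp
  qed
  show ?thesis
  proof (cases "A = 0")
    case False
    then have "\<gamma> = e1 + B / A" using AB unfolding e1_def by (simp add: field_simps)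
    then have "\<gamma> \<in> \<rat>" using rat ABC by (auto intro!: Rats_add Rats_divide)
    from degenerate_pair_cases[OF assms(1,2) pow n(1) this fac] show ?thesis by blast
  next
    case True
    then have "B = 0" using AB by simp
    with True have powC: "x ^ n = C" if "x \<in> {\<alpha>, \<beta>, \<gamma>}" for x
      using ABC(4)[OF roots[OF that]] by simp
    define R where "R = norm \<alpha>"
    have "R > 0" using nz by (simp add: R_def)
    have norm_eq: "norm x = R" if "x \<in> {\<alpha>, \<beta>, \<gamma>}" for x
    proof -
      have "norm x ^ n = R ^ n" using powC[OF that] powC[of \<alpha>] by (simp add: R_def flip: norm_power)
      then show ?thesis using n(1) by (metis R_def norm_ge_zero power_eq_iff_eq_base)
    qed
    have cnj: "x * cnj x = of_real (R ^ 2)" if "x \<in> {\<alpha>, \<beta>, \<gamma>}" for x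
      using norm_eq[OF that] by (simp only: complex_norm_square[symmetric])
    have real: "cnj e1 = e1" "cnj e2 = e2" "cnj e3 = e3" using e by auto
    \<comment> \<open>Conjugation sends each root x to R^2 / x, hence \<open>e1\<close> to R^2
      \<open>e2\<close> / \<open>e3\<close>; but \<open>e1\<close> is real.\<close>
    have "e3 * cnj e1 = e2 * of_real (R ^ 2)"
      using cnj[of \<alpha>] cnj[of \<beta>] cnj[of \<gamma>] unfolding e1_def e2_def e3_def complex_cnj_add insert_iff
      by simp algebra
    then have e31: "e3 * e1 = e2 * of_real (R ^ 2)" using real by simp
    show ?thesis
    proof (cases "e1 = 0")
      case True
      then have "e2 = 0" using e31 \<open>R > 0\<close> by simp
      then show ?thesis using True e ane by simp
    next
      case False
      define \<rho> where "\<rho> = e2 / e1"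
      \<comment> \<open>\<open>e3\<close> is real of modulus R^3. With the previous relation this
        yields \<rho>^2 = R^2, \<open>e2\<close> = \<rho> \<open>e1\<close> and \<open>e3\<close> =
        \<rho>^3, so that X - \<rho> divides the cubic.\<close>
      have "e3 ^ 2 = of_real (R ^ 2) ^ 3"
      proof -
        have "e3 * cnj e3 = of_real (R ^ 2) ^ 3"
          using cnj[of \<alpha>] cnj[of \<beta>] cnj[of \<gamma>] unfolding e3_def complex_cnj_mult insert_iff
          by simp algebra
        then show ?thesis using real by (simp add: power2_eq_square)
      qed
      then have "(e2 * of_real (R ^ 2)) ^ 2 = of_real (R ^ 2) ^ 3 * e1 ^ 2"
        unfolding e31[symmetric] by (simp add: power_mult_distrib)
      then have "of_real (R ^ 2) ^ 2 * (e2 ^ 2) = of_real (R ^ 2) ^ 2 * (of_real (R ^ 2) * e1 ^ 2)"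
        by algebra
      then have e22: "e2 ^ 2 = of_real (R ^ 2) * e1 ^ 2"
        using \<open>R > 0\<close> by (simp only: mult_cancel_left) simp
      have rho2: "\<rho> ^ 2 = of_real (R ^ 2)"
        using e22 False by (simp add: \<rho>_def field_simps)
      have e2': "e2 = \<rho> * e1" using False by (simp add: \<rho>_def)
      have "e3 = \<rho> ^ 3"
      proof -
        have "e3 * e1 = \<rho> ^ 3 * e1" using e31 e2' rho2 by algebra
        then show ?thesis using False by simp
      qed
      have "(\<rho> - \<alpha>) * (\<rho> - \<beta>) * (\<rho> - \<gamma>) = \<rho> ^ 3 - e1 * \<rho> ^ 2 + e2 * \<rho> - e3"
        unfolding e1_def e2_def e3_def by algebra
      also have "\<dots> = 0" using e2' \<open>e3 = \<rho> ^ 3\<close> by algebra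
      finally have root: "\<rho> = \<alpha> \<or> \<rho> = \<beta> \<or> \<rho> = \<gamma>" by auto
      have rr: "\<rho> \<in> \<rat>" unfolding \<rho>_def using rat by (intro Rats_divide)
      \<comment> \<open>If the rational root is \<alpha> rather than \<gamma>, the pair \<gamma>,
        \<beta> takes over, since all roots share their n-th power; but the pair must be distinct.
        If \<gamma> = \<beta>, then \<open>e1\<close> = \<alpha> + 2 \<gamma> makes \<gamma> itself
        rational. The same holds with \<alpha> and \<beta> exchanged.\<close>
      have double: "\<gamma> \<in> \<rat>" if "x \<in> \<rat>" "e1 = x + 2 * \<gamma>" for x
      proof -
        have "\<gamma> = (e1 - x) / 2" using that(2) by simp
        also have "\<dots> \<in> \<rat>" using that(1) rat(1) by (intro Rats_divide Rats_diff) auto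
        finally show ?thesis .
      qed
      have "e1 = \<alpha> + 2 * \<gamma>" if "\<gamma> = \<beta>" unfolding e1_def that by simp
      moreover have "e1 = \<beta> + 2 * \<gamma>" if "\<gamma> = \<alpha>" unfolding e1_def that by simp
      ultimately consider "\<gamma> \<in> \<rat>" | "\<alpha> \<in> \<rat>" "\<gamma> \<noteq> \<beta>" | "\<beta> \<in> \<rat>" "\<gamma> \<noteq> \<alpha>"
        using root rr double by blast
      then show ?thesis
      proof cases
        case 1
        from degenerate_pair_cases[OF assms(1,2) pow n(1) this fac] show ?thesis by blast
      next
        case 2
        have "\<gamma> ^ n = \<beta> ^ n" using powC by simp
        moreover have "of_int b = - of_int a * (\<gamma> + \<beta> + \<alpha>)"
          "of_int c = of_int a * (\<gamma> * \<beta> + \<beta> * \<alpha> + \<alpha> * \<gamma>)" "of_int d = - of_int a * \<gamma> * \<beta> * \<alpha>"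
          using fac by algebra+
        ultimately show ?thesis using degenerate_pair_cases[OF assms(1) 2(2) _ n(1) 2(1)] by blast
      next
        case 3
        have "\<gamma> ^ n = \<alpha> ^ n" using powC by simp
        moreover have "of_int b = - of_int a * (\<gamma> + \<alpha> + \<beta>)"
          "of_int c = of_int a * (\<gamma> * \<alpha> + \<alpha> * \<beta> + \<beta> * \<gamma>)" "of_int d = - of_int a * \<gamma> * \<alpha> * \<beta>"
          using fac by algebra+
        ultimately show ?thesis using degenerate_pair_cases[OF assms(1) 3(2) _ n(1) 3(1)] by blast
      qed
    qed
  qed
qed

section \<open>Cubics with a rational linear factor\<close>

lemma sum_inverse_squares_le: "(\<Sum>i=1..N. 1 / real i ^ 2) \<le> pi ^ 2 / 6"
proof -
  have "(\<Sum>i=1..N. 1 / real i ^ 2) = (\<Sum>i<N. 1 / real (i + 1) ^ 2)"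
    by (rule sum.reindex_bij_witness[of _ "\<lambda>i. i + 1" "\<lambda>i. i - 1"]) auto
  also have "\<dots> \<le> (\<Sum>i. 1 / real (i + 1) ^ 2)"
    using inverse_squares_sums by (intro sum_le_suminf) (auto dest: sums_summable simp: add.commute)
  also have "\<dots> = pi ^ 2 / 6"
    using inverse_squares_sums by (auto dest: sums_unique simp: add.commute)
  finally show ?thesis .
qed

section \<open>Factorisations of squares\<close>

text \<open>After division by the gcd, the two coprime cofactors have a square as product, so each
  is a square.\<close>

lemma square_product_decompose:
  fixes x y z :: nat
  assumes "x > 0" "y > 0" "x * y = z ^ 2"
  obtains g m n where "x = g * m ^ 2" "y = g * n ^ 2" "z = g * m * n" "g > 0" "m > 0" "n > 0"
proof -
  define g where "g = gcd x y"
  have "g > 0" using assms(1) by (simp add: g_def)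
  obtain x' y' where xy: "x = g * x'" "y = g * y'" "coprime x' y'"
    using assms(1) unfolding g_def
    by (metis gcd_coprime_exists gcd_eq_0_iff less_irrefl mult.commute)
  have e: "g ^ 2 * (x' * y') = z ^ 2"
    using assms(3) xy by (simp add: power2_eq_square algebra_simps)
  then have "g ^ 2 dvd z ^ 2" by (metis dvd_triv_left)
  then have "g dvd z" by simp
  then obtain w where w: "z = g * w" ..
  have "x' * y' = w ^ 2" using e w \<open>g > 0\<close> by (simp add: power_mult_distrib)
  then have "is_nth_power 2 (x' * y')" by (rule is_nth_powerI)
  then have "is_nth_power 2 x'" "is_nth_power 2 y'"
    using is_nth_power_mult_coprime_nat_iff[OF xy(3)] by auto
  then obtain m n where mn: "x' = m ^ 2" "y' = n ^ 2" by (auto elim!: is_nth_powerE)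
  have "w ^ 2 = (m * n) ^ 2" using \<open>x' * y' = w ^ 2\<close> mn by (simp add: power_mult_distrib)
  then have "w = m * n" by simp
  with that[of g m n] xy mn w assms \<open>g > 0\<close> show ?thesis by auto
qed

text \<open>A nonzero square is positive, so \<open>x\<close> and \<open>y\<close> share the sign
  \<epsilon>; the sign \<delta> of \<open>z\<close> is independent.\<close>

lemma square_product_decompose_int:
  fixes x y z :: int
  assumes "x \<noteq> 0" "y \<noteq> 0" "x * y = z ^ 2"
  obtains g m n :: nat and \<epsilon> \<delta> :: int
  where "x = \<epsilon> * int (g * m ^ 2)" "y = \<epsilon> * int (g * n ^ 2)" "z = \<delta> * int (g * m * n)"
    "\<epsilon> \<in> {1, -1}" "\<delta> \<in> {1, -1}" "g > 0" "m > 0" "n > 0"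
proof -
  have "\<bar>x\<bar> * \<bar>y\<bar> = \<bar>z\<bar> ^ 2" using assms(3) by (metis abs_mult abs_power2 power2_abs)
  then have "int (nat \<bar>x\<bar> * nat \<bar>y\<bar>) = int (nat \<bar>z\<bar> ^ 2)" by simp
  then have prod: "nat \<bar>x\<bar> * nat \<bar>y\<bar> = nat \<bar>z\<bar> ^ 2" by (simp only: of_nat_eq_iff)
  obtain g m n where gmn: "nat \<bar>x\<bar> = g * m ^ 2" "nat \<bar>y\<bar> = g * n ^ 2"
    "nat \<bar>z\<bar> = g * m * n" "g > 0" "m > 0" "n > 0"
    by (rule square_product_decompose[OF _ _ prod]) (use assms in auto)
  have abs: "\<bar>x\<bar> = int (g * m ^ 2)" "\<bar>y\<bar> = int (g * n ^ 2)" "\<bar>z\<bar> = int (g * m * n)"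
    unfolding gmn(1-3)[symmetric] by simp_all
  have "x * y \<ge> 0" unfolding assms(3) by simp
  moreover have "x * y \<noteq> 0" using assms(1,2) by simp
  ultimately have "x * y > 0" by linarith
  then have "sgn y = sgn x" by (auto simp: zero_less_mult_iff)
  show ?thesis
  proof (rule that[of "sgn x" g m n "if z < 0 then -1 else 1"])
    show "x = sgn x * int (g * m ^ 2)"
      using sgn_mult_abs[of x] unfolding abs(1) by simp
    show "y = sgn x * int (g * n ^ 2)"
      using sgn_mult_abs[of y] unfolding abs(2) \<open>sgn y = sgn x\<close> by simp
    show "z = (if z < 0 then -1 else 1) * int (g * m * n)" using abs(3) by auto
    show "sgn x \<in> {1, -1}" using assms(1) by (auto simp: sgn_if)
  qed (use gmn in auto)
qed

section \<open>Integer multiples of a fixed quadratic by linear factors\<close>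

lemma card_abs_mult_le:
  fixes p :: int
  assumes "p \<noteq> 0"
  shows "card {v. \<bar>v * p\<bar> \<le> int H} = 2 * (H div nat \<bar>p\<bar>) + 1" "finite {v. \<bar>v * p\<bar> \<le> int H}"
proof -
  define k where "k = H div nat \<bar>p\<bar>"
  have "\<bar>v * p\<bar> \<le> int H \<longleftrightarrow> \<bar>v\<bar> \<le> int k" for v
  proof -
    have "\<bar>v * p\<bar> \<le> int H \<longleftrightarrow> nat \<bar>v\<bar> * nat \<bar>p\<bar> \<le> H"
      by (simp add: abs_mult nat_le_iff flip: nat_mult_distrib)
    also have "\<dots> \<longleftrightarrow> nat \<bar>v\<bar> \<le> k"
      using assms by (simp add: k_def less_eq_div_iff_mult_less_eq)
    also have "\<dots> \<longleftrightarrow> \<bar>v\<bar> \<le> int k" by (rule nat_le_iff)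
    finally show ?thesis .
  qed
  then have "{v. \<bar>v * p\<bar> \<le> int H} = {v. \<bar>v\<bar> \<le> int k}" by (rule Collect_cong)
  also have "\<dots> = {- int k..int k}" by (auto simp: abs_le_iff)
  finally have "{v. \<bar>v * p\<bar> \<le> int H} = {- int k..int k}" .
  then show "card {v. \<bar>v * p\<bar> \<le> int H} = 2 * (H div nat \<bar>p\<bar>) + 1"
    "finite {v. \<bar>v * p\<bar> \<le> int H}" by (simp_all flip: k_def)
qed

text \<open>Bounding only the outer coefficients gives independent conditions on \<open>v\<close>
  and \<open>u\<close>. Excluding \<open>v = 0\<close> removes the additive 1 from the count of
  \<open>v\<close>; for \<open>u\<close> that 1 is absorbed because \<bar>r\<bar> \<le> H, which
  turns 2 into 3.\<close>

lemma card_linear_multiples_le: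
  fixes p q r :: int
  assumes "p \<noteq> 0" "r \<noteq> 0" "\<bar>r\<bar> \<le> int H"
  defines "G \<equiv> {(v * p, v * q - u * p, v * r - u * q, - u * r) | u v.
    v \<noteq> 0 \<and> \<bar>v * p\<bar> \<le> int H \<and> \<bar>u * r\<bar> \<le> int H}"
  shows "finite G" "real (card G) \<le> 6 * real H ^ 2 / (\<bar>real_of_int p\<bar> * \<bar>real_of_int r\<bar>)"
proof -
  let ?V = "{v. \<bar>v * p\<bar> \<le> int H} - {0}" and ?U = "{u. \<bar>u * r\<bar> \<le> int H}"
  have G: "G = (\<lambda>(v, u). (v * p, v * q - u * p, v * r - u * q, - u * r)) ` (?V \<times> ?U)"
    unfolding G_def by auto
  have fin: "finite (?V \<times> ?U)" using card_abs_mult_le(2) assms by blast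
  then show "finite G" unfolding G by (rule finite_imageI)
  have "card ?V = 2 * (H div nat \<bar>p\<bar>)"
    using card_abs_mult_le[OF assms(1), of H] by (subst card_Diff_singleton) auto
  then have V: "real (card ?V) \<le> 2 * (real H / \<bar>real_of_int p\<bar>)"
    using of_nat_div_le_of_nat[of H "nat \<bar>p\<bar>", where 'a = real] by simp
  have "1 \<le> real H / \<bar>real_of_int r\<bar>" using assms(2,3)
    by (simp add: field_simps)
  then have U: "real (card ?U) \<le> 3 * (real H / \<bar>real_of_int r\<bar>)"
    using of_nat_div_le_of_nat[of H "nat \<bar>r\<bar>", where 'a = real]
    unfolding card_abs_mult_le(1)[OF assms(2)] by simp
  have "real (card G) \<le> real (card (?V \<times> ?U))"
    unfolding G using card_image_le[OF fin] by simp
  also have "\<dots> = real (card ?V) * real (card ?U)" by (simp add: card_cartesian_product)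
  also have "\<dots> \<le> (2 * (real H / \<bar>real_of_int p\<bar>)) * (3 * (real H / \<bar>real_of_int r\<bar>))"
    using V U by (intro mult_mono) auto
  also have "\<dots> = 6 * real H ^ 2 / (\<bar>real_of_int p\<bar> * \<bar>real_of_int r\<bar>)"
    by (simp add: power2_eq_square)
  finally show "real (card G) \<le> 6 * real H ^ 2 / (\<bar>real_of_int p\<bar> * \<bar>real_of_int r\<bar>)" .
qed

definition split_cubics :: "nat \<Rightarrow> (int \<times> int \<times> int \<times> int) set" where
  "split_cubics H = {(a, b, c, d). linear_quadratic_split a b c d \<and>
     \<bar>a\<bar> \<le> int H \<and> \<bar>b\<bar> \<le> int H \<and> \<bar>c\<bar> \<le> int H \<and> \<bar>d\<bar> \<le> int H}"

lemma finite_split_cubics [simp]: "finite (split_cubics H)"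
  by (rule finite_subset[of _ "{-int H..int H} \<times> {-int H..int H} \<times> {-int H..int H} \<times> {-int H..int H}"])
    (auto simp: split_cubics_def abs_le_iff)

text \<open>Writing \<open>k p = \<plusminus>g m\<^sup>2\<close> and \<open>r = \<plusminus>g n\<^sup>2\<close>, the number of pairs \<open>(u, v)\<close> for given \<open>p\<close>, \<open>q\<close>, \<open>r\<close> is at most
  \<open>6 H\<^sup>2 / \<bar>p r\<bar> \<le> 18 H\<^sup>2 / (g m n)\<^sup>2\<close>, and the sum over \<open>g\<close>, \<open>m\<close>, \<open>n\<close> converges.\<close>

lemma card_split_cubics_le:
  "real (card (split_cubics H)) \<le> 216 * (pi ^ 2 / 6) ^ 3 * real H ^ 2"
proof -
  define G where "G = (\<lambda>(k, \<epsilon>, \<delta>, g, m, n). {(v * p, v * q - u * p, v * r - u * q, - u * r) | u v p q r.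
    k * p = \<epsilon> * int (g * m ^ 2) \<and> r = \<epsilon> * int (g * n ^ 2) \<and> q = \<delta> * int (g * m * n) \<and> \<bar>r\<bar> \<le> int H \<and>
    v \<noteq> 0 \<and> \<bar>v * p\<bar> \<le> int H \<and> \<bar>u * r\<bar> \<le> int H})"
  \<comment> \<open>The range \<open>3*H\<close> suffices: \<open>g\<close> and \<open>m\<close> are
    at most \<bar>k p\<bar> \<le> 3 H, and \<open>n\<close> is at most \<bar>r\<bar> \<le>
    H.\<close>
  define T where "T = {1::int, 2, 3} \<times> {1::int, -1} \<times> {1::int, -1} \<times> {1..3*H} \<times> {1..3*H} \<times> {1..3*H}"
  define w where "w = (\<lambda>i::nat. 1 / real i ^ 2)"
  have "finite T" by (simp add: T_def)
  have G: "finite (G y) \<and> real (card (G y)) \<le> 18 * real H ^ 2 *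
      (case y of (k, \<epsilon>, \<delta>, g, m, n) \<Rightarrow> w g * (w m * w n))" if "y \<in> T" for y
  proof -
    obtain k \<epsilon> \<delta> g m n where y: "y = (k, \<epsilon>, \<delta>, g, m, n)" by (cases y)
    have in_T: "k \<in> {1, 2, 3}" "\<epsilon> \<in> {1, -1}" "\<delta> \<in> {1, -1}" "g > 0" "m > 0" "n > 0"
      using that by (auto simp: y T_def)
    define r where "r = \<epsilon> * int (g * n ^ 2)"
    have "r \<noteq> 0" using in_T by (auto simp: r_def)
    show ?thesis
    proof (cases "\<bar>r\<bar> \<le> int H \<and> k dvd \<epsilon> * int (g * m ^ 2)")
      case True
      then obtain p where p: "\<epsilon> * int (g * m ^ 2) = k * p" by (auto elim: dvdE)
      have "p \<noteq> 0" using p in_T by (auto)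
      define q where "q = \<delta> * int (g * m * n)"
      have "k \<noteq> 0" using in_T by auto
      then have "k * p' = \<epsilon> * int (g * m ^ 2) \<longleftrightarrow> p' = p" for p' unfolding p by simp
      then have Gy: "G y = {(v * p, v * q - u * p, v * r - u * q, - u * r) | u v.
          v \<noteq> 0 \<and> \<bar>v * p\<bar> \<le> int H \<and> \<bar>u * r\<bar> \<le> int H}"
        using True unfolding G_def y r_def q_def prod.case by auto
      have bound: "real (card (G y)) \<le> 6 * real H ^ 2 / (\<bar>real_of_int p\<bar> * \<bar>real_of_int r\<bar>)"
        and fin: "finite (G y)"
        unfolding Gy using card_linear_multiples_le[OF \<open>p \<noteq> 0\<close> \<open>r \<noteq> 0\<close>] True by blast+
      have "\<bar>k\<bar> * \<bar>p\<bar> = int (g * m ^ 2)"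
        using in_T by (simp flip: abs_mult p) (auto simp: abs_mult)
      then have "int (g * m ^ 2) \<le> 3 * \<bar>p\<bar>" using in_T by auto
      then have "real_of_int (int (g * m ^ 2)) \<le> real_of_int (3 * \<bar>p\<bar>)" by (simp only: of_int_le_iff)
      then have pb: "real g * real m ^ 2 / 3 \<le> \<bar>real_of_int p\<bar>" by simp
      have "\<bar>r\<bar> = int (g * n ^ 2)" using in_T by (auto simp: r_def abs_mult)
      then have rb: "\<bar>real_of_int r\<bar> = real g * real n ^ 2"
        by (metis of_int_abs of_int_of_nat_eq of_nat_mult of_nat_power)
      have "6 * real H ^ 2 / (\<bar>real_of_int p\<bar> * \<bar>real_of_int r\<bar>) \<le>
          6 * real H ^ 2 / (real g * real m ^ 2 / 3 * (real g * real n ^ 2))"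
        using in_T pb \<open>p \<noteq> 0\<close> unfolding rb by (intro divide_left_mono mult_right_mono) (auto intro!: mult_pos_pos)
      also have "\<dots> = 18 * real H ^ 2 * (w g * (w m * w n))"
        by (simp add: w_def power2_eq_square)
      finally show ?thesis using bound fin unfolding y by simp
    next
      case False
      then have "G y = {}" unfolding G_def y r_def prod.case by (auto intro: dvdI[OF sym])
      then show ?thesis by (simp add: y w_def)
    qed
  qed
  have "split_cubics H \<subseteq> (\<Union>y\<in>T. G y)"
  proof
    fix f assume "f \<in> split_cubics H"
    then obtain a b c d u v p q r k where f: "f = (a, b, c, d)"
      and nz: "v \<noteq> 0" "p \<noteq> 0" "r \<noteq> 0" and k: "k \<in> {1, 2, 3}" and q: "q ^ 2 = k * p * r"
      and abcd: "a = v * p" "b = v * q - u * p" "c = v * r - u * q" "d = - u * r"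
      and H: "\<bar>a\<bar> \<le> int H" "\<bar>c\<bar> \<le> int H" "\<bar>d\<bar> \<le> int H"
      unfolding split_cubics_def linear_quadratic_split_def by blast
    have le_mult: "\<bar>x\<bar> \<le> \<bar>y * x\<bar>" if "y \<noteq> 0" for x y :: int
      using that mult_right_mono[of 1 "\<bar>y\<bar>" "\<bar>x\<bar>"] by (simp add: abs_mult)
    \<comment> \<open>The constant coefficient bounds \<open>r\<close> unless \<open>u = 0\<close>;
      in that case the linear coefficient is \<open>v * r\<close> and does so.\<close>
    have rH: "\<bar>r\<bar> \<le> int H"
    proof (cases "u = 0")
      case True
      then show ?thesis using H(2) abcd(3) le_mult[OF nz(1), of r] by simp
    next
      case False
      then show ?thesis using H(3) abcd(4) le_mult[of u r] by simp
    qed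
    have pH: "\<bar>p\<bar> \<le> int H" using H(1) abcd(1) le_mult[OF nz(1), of p] by simp
    have "k * p \<noteq> 0" using nz k by auto
    obtain g m n :: nat and \<epsilon> \<delta> :: int where gmn: "k * p = \<epsilon> * int (g * m ^ 2)" "r = \<epsilon> * int (g * n ^ 2)"
      "q = \<delta> * int (g * m * n)" "\<epsilon> \<in> {1, -1}" "\<delta> \<in> {1, -1}" "g > 0" "m > 0" "n > 0"
      by (rule square_product_decompose_int[OF \<open>k * p \<noteq> 0\<close> nz(3) q[symmetric]])
    have "int (g * m ^ 2) = \<bar>k * p\<bar>" using gmn(1,4) by (auto simp: abs_mult)
    also have "\<dots> \<le> 3 * int H" using k pH by (auto simp: abs_mult)
    finally have "g * m ^ 2 \<le> 3 * H" by linarith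
    moreover have "g \<le> g * m ^ 2" "m \<le> g * m ^ 2" "n \<le> g * n ^ 2"
      using gmn(6-8) by (simp_all add: power2_eq_square)
    moreover have "int (g * n ^ 2) = \<bar>r\<bar>" using gmn(2,4) by (auto simp: abs_mult)
    ultimately have "g \<le> 3 * H" "m \<le> 3 * H" "n \<le> 3 * H" using rH by linarith+
    then have "(k, \<epsilon>, \<delta>, g, m, n) \<in> T"
      using k gmn(4-8) unfolding T_def mem_Times_iff by simp
    moreover have "f \<in> G (k, \<epsilon>, \<delta>, g, m, n)"
      unfolding G_def prod.case f abcd using gmn(1-3) rH nz(1) H(1,3) abcd
      by (intro CollectI exI[of _ u] exI[of _ v] exI[of _ p] exI[of _ q] exI[of _ r]) simp
    ultimately show "f \<in> (\<Union>y\<in>T. G y)" by blast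
  qed
  then have "card (split_cubics H) \<le> card (\<Union>y\<in>T. G y)"
    using G \<open>finite T\<close> by (intro card_mono) auto
  also have "\<dots> \<le> (\<Sum>y\<in>T. card (G y))" by (rule card_UN_le[OF \<open>finite T\<close>])
  finally have "real (card (split_cubics H)) \<le> (\<Sum>y\<in>T. real (card (G y)))"
    by (simp only: of_nat_le_iff flip: of_nat_sum)
  also have "\<dots> \<le> (\<Sum>y\<in>T. 18 * real H ^ 2 * (case y of (k, \<epsilon>, \<delta>, g, m, n) \<Rightarrow> w g * (w m * w n)))"
    using G by (intro sum_mono) blast
  \<comment> \<open>216 = 18 * 3 * 2 * 2, for the choices of \<open>k\<close>, \<epsilon> and
    \<delta>.\<close>
  also have "\<dots> = 216 * real H ^ 2 * (\<Sum>i=1..3*H. w i) ^ 3"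
    unfolding T_def
    by (simp add: sum_distrib_left[symmetric] sum.cartesian_product[symmetric] power3_eq_cube
        sum_product[symmetric] sum_distrib_right[symmetric])
  also have "\<dots> \<le> 216 * real H ^ 2 * (pi ^ 2 / 6) ^ 3"
    unfolding w_def by (intro mult_left_mono power_mono sum_inverse_squares_le sum_nonneg) auto
  finally show ?thesis by (simp add: mult_ac)
qed

section \<open>Proportional quadruples\<close>

text \<open>Its cardinality is 1 for n = 1 and twice Euler's totient of n for n > 1.\<close>

definition coprime_pairs :: "nat \<Rightarrow> (nat \<times> nat) set" where
  "coprime_pairs n = {(x, y). 0 < x \<and> 0 < y \<and> max x y = n \<and> coprime x y}"

lemma finite_coprime_pairs [simp]: "finite (coprime_pairs n)"
  by (rule finite_subset[of _ "{..n} \<times> {..n}"]) (auto simp: coprime_pairs_def)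

text \<open>All pairs of positive integers with maximum n, two sides of a square sharing a corner,
  are sorted by their gcd e: dividing by e gives a coprime pair of maximum n / e.\<close>

lemma sum_card_coprime_pairs_divisors:
  assumes "n > 0"
  shows "(\<Sum>d | d dvd n. card (coprime_pairs d)) = 2 * n - 1"
proof -
  define S where "S = (SIGMA d:{d. d dvd n}. coprime_pairs d)"
  define P where "P = {(x, y). 0 < x \<and> 0 < y \<and> max x y = n}"
  define f where "f = (\<lambda>(d, x, y). (n div d * x, n div d * y))"
  define g where "g = (\<lambda>(x, y). (n div gcd x y, x div gcd x y, y div gcd x y))"
  have gf: "g (f (d, x, y)) = (d, x, y)" and f_in: "f (d, x, y) \<in> P"
    if "(d, x, y) \<in> S" for d x y
  proof -
    have xy: "coprime x y" "0 < x" "0 < y" "max x y = d" and "d dvd n"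
      using that by (simp_all add: S_def coprime_pairs_def)
    from \<open>d dvd n\<close> obtain e where e: "n = d * e" ..
    have "d > 0" "e > 0" using e assms by auto
    then have f: "f (d, x, y) = (e * x, e * y)" using e by (simp add: f_def)
    have "gcd (e * x) (e * y) = e" using xy by (simp flip: gcd_mult_distrib_nat)
    then show "g (f (d, x, y)) = (d, x, y)" using e \<open>e > 0\<close> by (simp add: g_def f)
    have "max (e * x) (e * y) = e * max x y" by (simp add: max_def)
    then show "f (d, x, y) \<in> P" using e \<open>e > 0\<close> xy by (simp add: f P_def mult.commute)
  qed
  have fg: "f (g (x, y)) = (x, y)" and g_in: "g (x, y) \<in> S" if "(x, y) \<in> P" for x y
  proof -
    define e where "e = gcd x y"
    have xy: "0 < x" "0 < y" "max x y = n" using that by (simp_all add: P_def)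
    have "e > 0" using xy by (simp add: e_def)
    obtain x' y' where *: "x = x' * e" "y = y' * e" "coprime x' y'"
      using gcd_coprime_exists[of x y] xy unfolding e_def by auto
    have n: "n = e * max x' y'" using xy(3) unfolding * by (auto simp: max_def mult.commute)
    have "x' > 0" "y' > 0" using xy * by (auto intro: gr0I)
    have g: "g (x, y) = (max x' y', x', y')"
      using \<open>e > 0\<close> unfolding g_def prod.case e_def[symmetric] by (simp add: n) (simp add: *)
    show "g (x, y) \<in> S"
      using *(3) \<open>x' > 0\<close> \<open>y' > 0\<close> unfolding g by (simp add: S_def coprime_pairs_def n)
    show "f (g (x, y)) = (x, y)"
      unfolding g using \<open>x' > 0\<close> by (simp add: f_def n) (simp add: * max_def mult.commute)
  qed
  have "bij_betw f S P"
    by (rule bij_betw_byWitness[where f' = g]) (use gf f_in fg g_in in auto)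
  then have "card S = card P" by (rule bij_betw_same_card)
  also have "P = {1..n} \<times> {n} \<union> {n} \<times> {1..n - 1}" using assms by (auto simp: P_def max_def)
  also have "card \<dots> = card ({1..n} \<times> {n}) + card ({n} \<times> {1..n - 1})"
    using assms by (intro card_Un_disjoint) auto
  finally show ?thesis using assms by (simp add: S_def card_cartesian_product)
qed

definition proportional_quads :: "nat \<Rightarrow> (nat \<times> nat \<times> nat \<times> nat) set" where
  "proportional_quads H = {(a, b, c, d). a \<in> {1..H} \<and> b \<in> {1..H} \<and> c \<in> {1..H} \<and> d \<in> {1..H} \<and> a * d = b * c}"

lemma finite_proportional_quads [simp]: "finite (proportional_quads H)"
  by (rule finite_subset[of _ "{1..H} \<times> {1..H} \<times> {1..H} \<times> {1..H}"]) (auto simp: proportional_quads_def)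

text \<open>The ratios a : b and c : d have the same reduced form x : y, and the scale factors are
  the two gcds. Only the larger of x and y restricts the scale factors, which range independently up
  to \<open>H div n\<close>; hence the square.\<close>

lemma card_proportional_quads:
  "card (proportional_quads H) = (\<Sum>n=1..H. card (coprime_pairs n) * (H div n) ^ 2)"
proof -
  define S where "S = (SIGMA n:{1..H}. coprime_pairs n \<times> {1..H div n} \<times> {1..H div n})"
  define f :: "nat \<times> (nat \<times> nat) \<times> nat \<times> nat \<Rightarrow> nat \<times> nat \<times> nat \<times> nat"
    where "f = (\<lambda>(n, (x, y), (s, t)). (x * s, y * s, x * t, y * t))"
  define g :: "nat \<times> nat \<times> nat \<times> nat \<Rightarrow> nat \<times> (nat \<times> nat) \<times> nat \<times> nat"
    where "g = (\<lambda>(a, b, c, d). (max (a div gcd a b) (b div gcd a b), (a div gcd a b, b div gcd a b), (gcd a b, gcd c d)))"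
  have gcd_mult: "gcd (x * s) (y * s) = s" if "coprime x y" for x y s :: nat
    using that by (simp add: mult.commute[of _ s] flip: gcd_mult_distrib_nat)
  have max_mult: "max x y * s \<le> H \<longleftrightarrow> x * s \<le> H \<and> y * s \<le> H" for x y s
    by (metis max.bounded_iff max_mult_distrib_right nat_mult_max_left)
  have gf: "g (f (n, (x, y), (s, t))) = (n, (x, y), (s, t))" and f_in: "f (n, (x, y), (s, t)) \<in> proportional_quads H"
    if "(n, (x, y), (s, t)) \<in> S" for n x y s t
  proof -
    have xy: "coprime x y" "0 < x" "0 < y" "n = max x y" and st: "0 < s" "0 < t" "s \<le> H div n" "t \<le> H div n"
      using that by (auto simp: S_def coprime_pairs_def)
    show "g (f (n, (x, y), (s, t))) = (n, (x, y), (s, t))"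
      using xy st by (simp add: f_def g_def gcd_mult)
    have "max x y * s \<le> H" "max x y * t \<le> H"
      using st(3,4) xy by (simp_all add: less_eq_div_iff_mult_less_eq mult.commute)
    then show "f (n, (x, y), (s, t)) \<in> proportional_quads H"
      using xy st unfolding max_mult by (simp add: f_def proportional_quads_def Suc_le_eq)
  qed
  have fg: "f (g (a, b, c, d)) = (a, b, c, d)" and g_in: "g (a, b, c, d) \<in> S"
    if "(a, b, c, d) \<in> proportional_quads H" for a b c d
  proof -
    define s where "s = gcd a b"
    have pos: "a > 0" "b > 0" "c > 0" "d > 0" and e: "a * d = b * c"
      and H: "a \<le> H" "b \<le> H" "c \<le> H" "d \<le> H"
      using that by (auto simp: proportional_quads_def)
    obtain x y where xy: "a = x * s" "b = y * s" "coprime x y"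
      using pos gcd_coprime_exists[of a b] unfolding s_def by auto
    have nz: "x > 0" "y > 0" "s > 0" using xy pos by (auto intro: gr0I)
    have "(x * d) * s = (y * c) * s" using e xy(1,2) by (simp add: mult_ac)
    then have xd: "x * d = y * c" using nz by simp
    then have "x dvd y * c" by (metis dvd_triv_left)
    then have "x dvd c" using xy(3) by (simp add: coprime_dvd_mult_right_iff)
    then obtain t where t: "c = x * t" ..
    then have d: "d = y * t" using xd nz by simp
    have "t > 0" using t pos by (auto intro: gr0I)
    have g: "g (a, b, c, d) = (max x y, (x, y), (s, t))"
      using xy nz t d by (simp add: g_def gcd_mult)
    show "f (g (a, b, c, d)) = (a, b, c, d)" unfolding g by (simp add: f_def xy t d)
    have le: "max x y * s \<le> H" "max x y * t \<le> H" unfolding max_mult using H xy t d by auto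
    moreover have "max x y * 1 \<le> max x y * s" using nz(3) by (intro mult_left_mono) auto
    ultimately have "max x y \<le> H" by linarith
    then show "g (a, b, c, d) \<in> S"
      using nz \<open>t > 0\<close> xy(3) le unfolding g
      by (simp add: S_def coprime_pairs_def less_eq_div_iff_mult_less_eq mult.commute Suc_le_eq)
  qed
  have "bij_betw f S (proportional_quads H)"
  proof (rule bij_betw_byWitness[where f' = g])
    show "\<forall>z\<in>S. g (f z) = z" "f ` S \<subseteq> proportional_quads H"
      using gf f_in by auto
    show "\<forall>z\<in>proportional_quads H. f (g z) = z" "g ` proportional_quads H \<subseteq> S"
      using fg g_in by auto
  qed
  then have "card (proportional_quads H) = card S" by (rule bij_betw_same_card[symmetric])
  also have "\<dots> = (\<Sum>n=1..H. card (coprime_pairs n) * (H div n) ^ 2)"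
    by (simp add: S_def card_cartesian_product power2_eq_square)
  finally show ?thesis .
qed

section \<open>Signs and vanishing coefficients\<close>

text \<open>These are the cubics (a X + b)(a X^2 + c) / a; the condition on \<open>c\<close> makes
  the two opposite roots distinct.\<close>

definition proportional_cubics :: "nat \<Rightarrow> (int \<times> int \<times> int \<times> int) set" where
  "proportional_cubics H = {(a, b, c, d). a \<noteq> 0 \<and> c \<noteq> 0 \<and> a * d = b * c \<and>
     \<bar>a\<bar> \<le> int H \<and> \<bar>b\<bar> \<le> int H \<and> \<bar>c\<bar> \<le> int H \<and> \<bar>d\<bar> \<le> int H}"

lemma finite_proportional_cubics [simp]: "finite (proportional_cubics H)"
  by (rule finite_subset[of _ "{-int H..int H} \<times> {-int H..int H} \<times> {-int H..int H} \<times> {-int H..int H}"])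
    (auto simp: proportional_cubics_def abs_le_iff)

text \<open>The signs of \<open>a\<close>, \<open>b\<close>, \<open>c\<close> are free and determine
  that of \<open>d\<close>. If \<open>b = 0\<close> then \<open>d = 0\<close>, which leaves two free
  nonzero entries.\<close>

lemma card_proportional_cubics:
  "card (proportional_cubics H) = 8 * card (proportional_quads H) + (2 * H) ^ 2"
proof -
  let ?N = "{-int H..int H} - {0}"
  define Z where "Z = (\<lambda>(a, c). (a, 0::int, c, 0::int)) ` (?N \<times> ?N)"
  define Q where "Q = {(a, b, c, d) \<in> proportional_cubics H. b \<noteq> 0}"
  define S where "S = {1::int, -1} \<times> {1::int, -1} \<times> {1::int, -1} \<times> proportional_quads H"
  define f :: "int \<times> int \<times> int \<times> nat \<times> nat \<times> nat \<times> nat \<Rightarrow> int \<times> int \<times> int \<times> int"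
    where "f = (\<lambda>(\<epsilon>1, \<epsilon>2, \<epsilon>3, (a, b, c, d)). (\<epsilon>1 * int a, \<epsilon>2 * int b, \<epsilon>3 * int c, \<epsilon>1 * \<epsilon>2 * \<epsilon>3 * int d))"
  define g :: "int \<times> int \<times> int \<times> int \<Rightarrow> int \<times> int \<times> int \<times> nat \<times> nat \<times> nat \<times> nat"
    where "g = (\<lambda>(a, b, c, d). (sgn a, sgn b, sgn c, (nat \<bar>a\<bar>, nat \<bar>b\<bar>, nat \<bar>c\<bar>, nat \<bar>d\<bar>)))"
  have gf: "g (f (\<epsilon>1, \<epsilon>2, \<epsilon>3, (a, b, c, d))) = (\<epsilon>1, \<epsilon>2, \<epsilon>3, (a, b, c, d))"
    and f_in: "f (\<epsilon>1, \<epsilon>2, \<epsilon>3, (a, b, c, d)) \<in> Q"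
    if "(\<epsilon>1, \<epsilon>2, \<epsilon>3, (a, b, c, d)) \<in> S" for \<epsilon>1 \<epsilon>2 \<epsilon>3 a b c d
  proof -
    have \<epsilon>: "\<epsilon>1 \<in> {1, -1}" "\<epsilon>2 \<in> {1, -1}" "\<epsilon>3 \<in> {1, -1}"
      and pos: "a > 0" "b > 0" "c > 0" "d > 0" and e: "a * d = b * c"
      and H: "a \<le> H" "b \<le> H" "c \<le> H" "d \<le> H"
      using that by (simp_all add: S_def proportional_quads_def)
    have abs: "\<bar>\<epsilon>1\<bar> = 1" "\<bar>\<epsilon>2\<bar> = 1" "\<bar>\<epsilon>3\<bar> = 1" and sgn: "sgn \<epsilon>1 = \<epsilon>1" "sgn \<epsilon>2 = \<epsilon>2" "sgn \<epsilon>3 = \<epsilon>3"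
      and sq: "\<epsilon>1 * \<epsilon>1 = 1" and nz: "\<epsilon>1 \<noteq> 0" "\<epsilon>2 \<noteq> 0" "\<epsilon>3 \<noteq> 0"
      using \<epsilon> by auto
    show "g (f (\<epsilon>1, \<epsilon>2, \<epsilon>3, (a, b, c, d))) = (\<epsilon>1, \<epsilon>2, \<epsilon>3, (a, b, c, d))"
      using pos by (simp add: f_def g_def abs_mult sgn_mult abs sgn)
    have "int a * int d = int b * int c" using e by (metis of_nat_mult)
    moreover have "(\<epsilon>1 * int a) * (\<epsilon>1 * \<epsilon>2 * \<epsilon>3 * int d) = (\<epsilon>1 * \<epsilon>1) * (\<epsilon>2 * \<epsilon>3) * (int a * int d)"
      by (simp only: mult_ac)
    ultimately have "(\<epsilon>1 * int a) * (\<epsilon>1 * \<epsilon>2 * \<epsilon>3 * int d) = (\<epsilon>2 * int b) * (\<epsilon>3 * int c)"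
      by (simp add: sq)
    then show "f (\<epsilon>1, \<epsilon>2, \<epsilon>3, (a, b, c, d)) \<in> Q"
      unfolding f_def Q_def proportional_cubics_def using pos H nz by (simp add: abs_mult abs)
  qed
  have fg: "f (g (a, b, c, d)) = (a, b, c, d)" and g_in: "g (a, b, c, d) \<in> S"
    if "(a, b, c, d) \<in> Q" for a b c d
  proof -
    have e: "a * d = b * c" and nz: "a \<noteq> 0" "b \<noteq> 0" "c \<noteq> 0"
      and H: "\<bar>a\<bar> \<le> int H" "\<bar>b\<bar> \<le> int H" "\<bar>c\<bar> \<le> int H" "\<bar>d\<bar> \<le> int H"
      using that by (auto simp: Q_def proportional_cubics_def)
    have "sgn a * sgn d = sgn b * sgn c" using e by (simp flip: sgn_mult)
    then have "sgn d = sgn a * sgn b * sgn c" using nz by (auto simp: sgn_if split: if_splits)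
    then have "sgn a * sgn b * sgn c * \<bar>d\<bar> = d" by (metis sgn_mult_abs)
    then show "f (g (a, b, c, d)) = (a, b, c, d)" by (simp add: f_def g_def sgn_mult_abs)
    have "d \<noteq> 0" using e nz by auto
    moreover have "nat \<bar>a\<bar> * nat \<bar>d\<bar> = nat \<bar>b\<bar> * nat \<bar>c\<bar>"
      using e by (simp flip: nat_mult_distrib abs_mult)
    moreover have "sgn x \<in> {1, -1}" if "x \<noteq> 0" for x :: int using that by (simp add: sgn_if)
    ultimately show "g (a, b, c, d) \<in> S"
      using nz H unfolding S_def g_def prod.case mem_Times_iff fst_conv snd_conv
      by (simp add: proportional_quads_def Suc_le_eq nat_le_iff)
  qed
  have "bij_betw f S Q"
  proof (rule bij_betw_byWitness[where f' = g])
    show "\<forall>z\<in>S. g (f z) = z" "f ` S \<subseteq> Q" using gf f_in by (clarsimp, force)+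
    show "\<forall>z\<in>Q. f (g z) = z" "g ` Q \<subseteq> S" using fg g_in by (clarsimp, force)+
  qed
  then have "card Q = card S" by (rule bij_betw_same_card[symmetric])
  then have Q: "card Q = 8 * card (proportional_quads H)" by (simp add: S_def card_cartesian_product)
  have "card Z = card (?N \<times> ?N)" unfolding Z_def by (rule card_image) (auto simp: inj_on_def)
  moreover have "card ?N = 2 * H" by (subst card_Diff_singleton) auto
  ultimately have Z: "card Z = (2 * H) ^ 2"
    by (simp only: card_cartesian_product power2_eq_square)
  have "proportional_cubics H = Q \<union> Z"
  proof (rule set_eqI)
    fix z :: "int \<times> int \<times> int \<times> int"
    obtain a b c d where z: "z = (a, b, c, d)" by (cases z)
    have "z \<in> Z \<longleftrightarrow> z \<in> proportional_cubics H \<and> b = 0"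
      unfolding Z_def z by (auto simp: proportional_cubics_def abs_le_iff image_iff)
    then show "z \<in> proportional_cubics H \<longleftrightarrow> z \<in> Q \<union> Z" unfolding Q_def z by auto
  qed
  moreover have "Q \<inter> Z = {}" by (auto simp: Q_def Z_def)
  moreover have "finite Z" unfolding Z_def by simp
  moreover have "finite Q"
    unfolding Q_def by (rule finite_subset[OF _ finite_proportional_cubics[of H]]) auto
  ultimately show ?thesis using Q Z by (simp add: card_Un_disjoint)
qed

section \<open>Asymptotics\<close>

text \<open>What remains of the count of proportional quadruples, divided by H^2, when
  \<open>H div n\<close> is replaced by H / n.\<close>

definition coprime_density_sum :: "nat \<Rightarrow> real" where
  "coprime_density_sum N = (\<Sum>n=1..N. real (card (coprime_pairs n)) / real n ^ 2)"

lemma card_coprime_pairs_le: "card (coprime_pairs n) \<le> 2 * n"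
proof (cases "n = 0")
  case True
  then have "coprime_pairs n = {}" by (auto simp: coprime_pairs_def)
  then show ?thesis by simp
next
  case False
  then have "card (coprime_pairs n) \<le> (\<Sum>d | d dvd n. card (coprime_pairs d))"
    by (intro member_le_sum) auto
  also have "\<dots> = 2 * n - 1" using sum_card_coprime_pairs_divisors False by simp
  finally show ?thesis by simp
qed

text \<open>The divisor identity is summed with weight 1 / n^2. Writing n = m d splits the weight,
  and for fixed m the variable d runs up to \<open>N div m\<close>.\<close>

lemma sum_odd_over_squares_eq:
  "(\<Sum>n=1..N. (2 * real n - 1) / real n ^ 2) = (\<Sum>m=1..N. coprime_density_sum (N div m) / real m ^ 2)"
proof -
  let ?c = "\<lambda>d. real (card (coprime_pairs d))"
  have "(\<Sum>n=1..N. (2 * real n - 1) / real n ^ 2) = (\<Sum>n=1..N. \<Sum>d | d dvd n. ?c d / real n ^ 2)"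
  proof (rule sum.cong)
    fix n assume n: "n \<in> {1..N}"
    have "(\<Sum>d | d dvd n. ?c d / real n ^ 2) = real (\<Sum>d | d dvd n. card (coprime_pairs d)) / real n ^ 2"
      by (simp add: sum_divide_distrib)
    also have "\<dots> = (2 * real n - 1) / real n ^ 2"
      using n by (simp add: sum_card_coprime_pairs_divisors of_nat_diff)
    finally show "(2 * real n - 1) / real n ^ 2 = (\<Sum>d | d dvd n. ?c d / real n ^ 2)" ..
  qed simp
  also have "\<dots> = (\<Sum>(n, d)\<in>(SIGMA n:{1..N}. {d. d dvd n}). ?c d / real n ^ 2)"
    by (rule sum.Sigma) auto
  also have "\<dots> = (\<Sum>(m, d)\<in>(SIGMA m:{1..N}. {1..N div m}). ?c d / real d ^ 2 / real m ^ 2)"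
  proof (rule sum.reindex_bij_witness[of _ "\<lambda>(m, d). (m * d, d)" "\<lambda>(n, d). (n div d, d)"])
    fix z assume "z \<in> (SIGMA n:{1..N}. {d. d dvd n})"
    then obtain m d where z: "z = (d * m, d)" and pos: "0 < d * m" "d * m \<le> N" by (auto elim!: dvdE)
    have "m \<le> d * m" using pos by simp
    then have "m \<le> N" using pos by linarith
    with pos show "(case z of (n, d) \<Rightarrow> (n div d, d)) \<in> (SIGMA m:{1..N}. {1..N div m})"
      by (auto simp: z less_eq_div_iff_mult_less_eq Suc_le_eq)
    show "(case case z of (n, d) \<Rightarrow> (n div d, d) of (m, d) \<Rightarrow> (m * d, d)) = z"
      "(case case z of (n, d) \<Rightarrow> (n div d, d) of (m, d) \<Rightarrow> ?c d / real d ^ 2 / real m ^ 2) =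
        (case z of (n, d) \<Rightarrow> ?c d / real n ^ 2)"
      using pos by (auto simp: z power_mult_distrib)
  next
    fix z assume "z \<in> (SIGMA m:{1..N}. {1..N div m})"
    then show "(case z of (m, d) \<Rightarrow> (m * d, d)) \<in> (SIGMA n:{1..N}. {d. d dvd n})"
      "(case case z of (m, d) \<Rightarrow> (m * d, d) of (n, d) \<Rightarrow> (n div d, d)) = z"
      by (auto simp: less_eq_div_iff_mult_less_eq Suc_le_eq mult.commute)
  qed
  also have "\<dots> = (\<Sum>m=1..N. \<Sum>d=1..N div m. ?c d / real d ^ 2 / real m ^ 2)"
    by (rule sum.Sigma[symmetric]) auto
  finally show ?thesis by (simp add: coprime_density_sum_def sum_divide_distrib)
qed

text \<open>The summands lie between 0 and 2 / n, so the difference is at most twice a difference of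
  harmonic numbers, which is at most a difference of logarithms because \<open>harm n - ln n\<close>
  decreases.\<close>

lemma coprime_density_sum_diff_bounds:
  assumes "1 \<le> m" "m \<le> N"
  shows "coprime_density_sum (N div m) \<le> coprime_density_sum N"
    "coprime_density_sum N - coprime_density_sum (N div m) \<le> 2 * ln (2 * real m)"
proof -
  define k where "k = N div m"
  have k: "1 \<le> k" "k \<le> N" using assms by (simp_all add: k_def Suc_le_eq div_greater_zero_iff)
  have split: "(\<Sum>n=1..N. f n) = (\<Sum>n=1..k. f n) + (\<Sum>n\<in>{k<..N}. f n)" for f :: "nat \<Rightarrow> real"
  proof -
    have "{1..N} = {1..k} \<union> {k<..N}" using k by auto
    moreover have "{1..k} \<inter> {k<..N} = {}" by auto
    ultimately show ?thesis by (simp only: sum.union_disjoint finite_atLeastAtMost finite_greaterThanAtMost)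
  qed
  have diff: "coprime_density_sum N - coprime_density_sum k = (\<Sum>n\<in>{k<..N}. real (card (coprime_pairs n)) / real n ^ 2)"
    unfolding coprime_density_sum_def by (subst split) simp
  also have "\<dots> \<ge> 0" by (intro sum_nonneg) auto
  finally show "coprime_density_sum (N div m) \<le> coprime_density_sum N" by (simp add: k_def)
  have "real (card (coprime_pairs n)) / real n ^ 2 \<le> 2 * inverse (real n)" if "n \<in> {k<..N}" for n
  proof -
    have "real (card (coprime_pairs n)) \<le> 2 * real n" using card_coprime_pairs_le[of n] by linarith
    then have "real (card (coprime_pairs n)) / real n ^ 2 \<le> 2 * real n / real n ^ 2"
      by (rule divide_right_mono) simp
    then show ?thesis using that by (simp add: field_simps power2_eq_square)
  qed
  then have "coprime_density_sum N - coprime_density_sum k \<le> (\<Sum>n\<in>{k<..N}. 2 * inverse (real n))"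
    unfolding diff by (rule sum_mono)
  also have "\<dots> = 2 * (harm N - harm k)"
    unfolding harm_def by (subst split) (simp add: sum_distrib_left)
  also have "\<dots> \<le> 2 * (ln (real N) - ln (real k))"
    using euler_mascheroni_sequence_decreasing[of k N] k by simp
  also have "\<dots> = 2 * ln (real N / real k)" using k by (simp add: ln_div)
  also have "\<dots> \<le> 2 * ln (2 * real m)"
  proof -
    \<comment> \<open>As k \<ge> 1, rounding down costs at most a factor 2, the source of the 2
      inside the logarithm.\<close>
    have "N < m * (k + 1)" using assms unfolding k_def by (simp add: dividend_less_times_div)
    also have "\<dots> \<le> m * (2 * k)" using k by (intro mult_left_mono) auto
    finally have "real N \<le> real (m * (2 * k))" by linarith
    then have "real N / real k \<le> 2 * real m" using k by (simp add: field_simps)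
    then show ?thesis using k assms by simp
  qed
  finally show "coprime_density_sum N - coprime_density_sum (N div m) \<le> 2 * ln (2 * real m)"
    by (simp add: k_def)
qed

section \<open>Convergent series and logarithmic limits\<close>

lemma ln_over_square_summable: "summable (\<lambda>m. ln (2 * real m) / real m ^ 2)"
proof (rule summable_comparison_test_bigo)
  \<comment> \<open>Any exponent strictly between -2 and -1 absorbs the logarithm and keeps the
    series convergent.\<close>
  show "summable (\<lambda>m. norm (real m powr (-3 / 2)))" by (simp add: summable_real_powr_iff)
  show "(\<lambda>m. ln (2 * real m) / real m ^ 2) \<in> O(\<lambda>m. real m powr (-3 / 2))" by real_asymp
qed

lemma sum_inverse_squares_tendsto: "(\<lambda>N. \<Sum>i=1..N. 1 / real i ^ 2) \<longlonglongrightarrow> pi ^ 2 / 6"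
proof -
  have "(\<Sum>i=1..N. 1 / real i ^ 2) = (\<Sum>i<N. 1 / real (i + 1) ^ 2)" for N
    by (rule sum.reindex_bij_witness[of _ "\<lambda>i. i + 1" "\<lambda>i. i - 1"]) auto
  then show ?thesis using inverse_squares_sums by (simp add: sums_def add.commute)
qed

lemma harm_over_ln_tendsto: "(\<lambda>N. harm N / ln (real N)) \<longlonglongrightarrow> (1 :: real)"
proof -
  have "(\<lambda>N. (harm N - ln (real N)) * inverse (ln (real N)) + ln (real N) / ln (real N)) \<longlonglongrightarrow> euler_mascheroni * 0 + 1"
    by (intro tendsto_add tendsto_mult euler_mascheroni_LIMSEQ) real_asymp+
  moreover have "\<forall>\<^sub>F N in sequentially. (harm N - ln (real N)) * inverse (ln (real N)) + ln (real N) / ln (real N) = harm N / ln (real N)"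
    using eventually_gt_at_top[of 1] by eventually_elim (simp add: field_simps)
  ultimately have "(\<lambda>N. harm N / ln (real N)) \<longlonglongrightarrow> euler_mascheroni * 0 + (1 :: real)"
    by (rule Lim_transform_eventually)
  then show ?thesis by simp
qed

lemma bounded_over_ln_tendsto_0:
  fixes e :: "nat \<Rightarrow> real"
  assumes "\<And>N. \<bar>e N\<bar> \<le> K"
  shows "(\<lambda>N. e N / ln (real N)) \<longlonglongrightarrow> 0"
proof (rule Lim_null_comparison)
  show "\<forall>\<^sub>F N in sequentially. norm (e N / ln (real N)) \<le> K / ln (real N)"
    using eventually_gt_at_top[of 1] by eventually_elim (use assms in \<open>auto simp: abs_divide intro!: divide_right_mono\<close>)
  show "(\<lambda>N. K / ln (real N)) \<longlonglongrightarrow> 0" by real_asymp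
qed

text \<open>Since \<open>coprime_density_sum (N div m)\<close> differs from \<open>coprime_density_sum N\<close> by \<open>O(ln m)\<close>, the
  convolution identity \<open>sum_odd_over_squares_eq\<close> says that \<open>2 * harm N\<close> is \<open>\<zeta>(2) * coprime_density_sum N\<close>
  up to a bounded error; no Moebius inversion is needed.\<close>

lemma coprime_density_sum_asymptotics:
  "(\<lambda>N. coprime_density_sum N / ln (real N)) \<longlonglongrightarrow> 12 / pi ^ 2"
proof -
  let ?F = coprime_density_sum
  define Z where "Z = (\<lambda>N. \<Sum>i=1..N. 1 / real i ^ 2)"
  define e where "e = (\<lambda>N. \<Sum>m=1..N. (?F N - ?F (N div m)) / real m ^ 2)"
  define K where "K = (\<Sum>m. ln (2 * real m) / real m ^ 2)"
  have e_bound: "\<bar>e N\<bar> \<le> 2 * K" for N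
  proof -
    have "0 \<le> e N"
      unfolding e_def using coprime_density_sum_diff_bounds(1) by (intro sum_nonneg) auto
    have "e N \<le> (\<Sum>m=1..N. 2 * (ln (2 * real m) / real m ^ 2))"
      unfolding e_def
    proof (rule sum_mono)
      fix m assume "m \<in> {1..N}"
      then have "?F N - ?F (N div m) \<le> 2 * ln (2 * real m)"
        by (intro coprime_density_sum_diff_bounds(2)) auto
      from divide_right_mono[OF this, of "real m ^ 2"]
      show "(?F N - ?F (N div m)) / real m ^ 2 \<le> 2 * (ln (2 * real m) / real m ^ 2)" by simp
    qed
    also have "\<dots> = 2 * (\<Sum>m=1..N. ln (2 * real m) / real m ^ 2)" by (simp add: sum_distrib_left)
    also have "(\<Sum>m=1..N. ln (2 * real m) / real m ^ 2) \<le> K"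
      unfolding K_def
    proof (rule sum_le_suminf[OF ln_over_square_summable])
      show "0 \<le> ln (2 * real m) / real m ^ 2" for m by (cases "m = 0") auto
    qed simp
    finally show ?thesis using \<open>0 \<le> e N\<close> by simp
  qed
  have Z_bound: "\<bar>Z N\<bar> \<le> pi ^ 2 / 6" for N
    using sum_inverse_squares_le[of N] unfolding Z_def by (simp add: sum_nonneg)
  have "e N = Z N * ?F N - (\<Sum>n=1..N. (2 * real n - 1) / real n ^ 2)" for N
    unfolding sum_odd_over_squares_eq e_def Z_def
    by (simp add: diff_divide_distrib sum_subtractf sum_distrib_right)
  moreover have "(\<Sum>n=1..N. (2 * real n - 1) / real n ^ 2) = 2 * harm N - Z N" for N
  proof -
    have "(\<Sum>n=1..N. (2 * real n - 1) / real n ^ 2) = (\<Sum>n=1..N. 2 * inverse (real n) - 1 / real n ^ 2)"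
      by (intro sum.cong) (auto simp: field_simps power2_eq_square)
    then show ?thesis by (simp add: sum_subtractf harm_def Z_def sum_distrib_left)
  qed
  ultimately have "Z N * ?F N = 2 * harm N - Z N + e N" for N by simp
  moreover have "Z N > 0" if "N > 0" for N
    unfolding Z_def using that by (intro sum_pos) auto
  ultimately have F: "?F N = (2 * harm N - Z N + e N) / Z N" if "N > 0" for N
    using that by (metis less_irrefl nonzero_mult_div_cancel_left)
  \<comment> \<open>Both \<open>Z\<close> and \<open>e\<close> are bounded, so they vanish after
    division by the logarithm; the denominator tends to \<zeta>(2), which gives 2 / (pi^2 / 6) = 12
    / pi^2.\<close>
  have "(\<lambda>N. (2 * (harm N / ln (real N)) - Z N / ln (real N) + e N / ln (real N)) / Z N)
      \<longlonglongrightarrow> (2 * 1 - 0 + 0) / (pi ^ 2 / 6)"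
    by (intro tendsto_intros harm_over_ln_tendsto bounded_over_ln_tendsto_0[OF Z_bound]
        bounded_over_ln_tendsto_0[OF e_bound] sum_inverse_squares_tendsto[folded Z_def]) auto
  moreover have "\<forall>\<^sub>F N in sequentially.
      (2 * (harm N / ln (real N)) - Z N / ln (real N) + e N / ln (real N)) / Z N = ?F N / ln (real N)"
    using eventually_gt_at_top[of 0]
    by eventually_elim (simp add: F add_divide_distrib diff_divide_distrib mult.commute)
  ultimately show ?thesis by (simp add: tendsto_cong)
qed

text \<open>Rounding x = H / n down changes x^2 by at most 2 x. Weighted by at most 2 n pairs, each
  of the H values of n contributes an error of at most 4 H.\<close>

lemma card_proportional_quads_approx:
  "\<bar>real (card (proportional_quads H)) - real H ^ 2 * coprime_density_sum H\<bar> \<le> 4 * real H ^ 2"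
proof -
  let ?c = "\<lambda>n. real (card (coprime_pairs n))"
  have summand: "\<bar>?c n * (real (H div n) ^ 2 - (real H / real n) ^ 2)\<bar> \<le> 4 * real H" if "n \<in> {1..H}" for n
  proof -
    have n: "n > 0" using that by simp
    define x where "x = real H / real n"
    define y where "y = real (H div n)"
    have y: "0 \<le> y" "y \<le> x" unfolding x_def y_def by (simp_all add: of_nat_div_le_of_nat)
    have "H < n * (H div n + 1)" using n by (simp add: dividend_less_times_div)
    then have "real H \<le> real (n * (H div n + 1))" by linarith
    then have x1: "x \<le> y + 1" unfolding x_def y_def using n by (simp add: field_simps)
    have "x ^ 2 - y ^ 2 = (x - y) * (x + y)" by (simp add: power2_eq_square algebra_simps)
    also have "\<dots> \<le> 1 * (2 * x)" using x1 y by (intro mult_mono) auto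
    finally have "x ^ 2 - y ^ 2 \<le> 2 * x" by simp
    moreover have "y ^ 2 \<le> x ^ 2" using y by (intro power_mono) auto
    ultimately have "\<bar>y ^ 2 - x ^ 2\<bar> \<le> 2 * x" by simp
    moreover have "?c n \<le> 2 * real n" using card_coprime_pairs_le[of n] by linarith
    ultimately have "?c n * \<bar>y ^ 2 - x ^ 2\<bar> \<le> 2 * real n * (2 * x)" by (intro mult_mono) auto
    also have "\<dots> = 4 * real H" using n by (simp add: x_def)
    finally show ?thesis by (simp add: abs_mult x_def y_def)
  qed
  have "real (card (proportional_quads H)) - real H ^ 2 * coprime_density_sum H =
      (\<Sum>n=1..H. ?c n * (real (H div n) ^ 2 - (real H / real n) ^ 2))"
    unfolding card_proportional_quads coprime_density_sum_def
    by (simp add: sum_distrib_left right_diff_distrib power_divide mult.commute flip: sum_subtractf)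
  also have "\<bar>\<dots>\<bar> \<le> (\<Sum>n=1..H. 4 * real H)"
    using summand by (intro sum_abs[THEN order_trans] sum_mono) auto
  finally show ?thesis by (simp add: power2_eq_square)
qed

section \<open>Counting degenerate cubics\<close>

lemma cubic_coeffs:
  assumes "degree f \<le> 3"
  shows "f = [:coeff f 0, coeff f 1, coeff f 2, coeff f 3:]"
  using assms
  by (intro poly_eqI) (auto simp: coeff_pCons numeral_2_eq_2 numeral_3_eq_3 coeff_eq_0 split: nat.splits)

lemma poly_cubic:
  "poly (map_poly of_int [:d, c, b, a:]) z = of_int a * z ^ 3 + of_int b * z ^ 2 + of_int c * z + (of_int d :: complex)"
  by (simp add: map_poly_pCons power2_eq_square power3_eq_cube algebra_simps)

text \<open>The two square roots of -c / a are roots of the cubic, and their quotient -1 is a root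
  of unity.\<close>

lemma degenerate_cubics_lower:
  "(\<lambda>(a, b, c, d). [:d, c, b, a:]) ` proportional_cubics H \<subseteq> degenerate_cubics H"
proof clarify
  fix a b c d assume "(a, b, c, d) \<in> proportional_cubics H"
  then have nz: "a \<noteq> 0" "c \<noteq> 0" and e: "a * d = b * c" and H: "\<bar>a\<bar> \<le> int H" "\<bar>b\<bar> \<le> int H" "\<bar>c\<bar> \<le> int H" "\<bar>d\<bar> \<le> int H"
    by (auto simp: proportional_cubics_def)
  define \<alpha> where "\<alpha> = csqrt (- of_int c / of_int a)"
  have sq: "\<alpha> ^ 2 = - of_int c / of_int a" by (simp add: \<alpha>_def)
  have "\<alpha> \<noteq> 0" using nz by (simp add: \<alpha>_def)
  have root: "poly (map_poly of_int [:d, c, b, a:]) z = 0" if "z ^ 2 = - of_int c / of_int a" for z :: complex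
  proof -
    have "of_int a * z ^ 2 = - of_int c" using that nz by simp
    moreover have "of_int a * of_int d = (of_int b * of_int c :: complex)" using e by (metis of_int_mult)
    ultimately have "of_int a * (of_int a * z ^ 3 + of_int b * z ^ 2 + of_int c * z + of_int d) = 0" by algebra
    then show ?thesis using nz unfolding poly_cubic by simp
  qed
  have "degenerate (map_poly of_int [:d, c, b, a:])"
    unfolding degenerate_def
  proof (intro exI conjI)
    show "poly (map_poly of_int [:d, c, b, a:]) \<alpha> = 0" "poly (map_poly of_int [:d, c, b, a:]) (- \<alpha>) = 0"
      using root sq by simp_all
    show "\<alpha> \<noteq> - \<alpha>" using \<open>\<alpha> \<noteq> 0\<close> by (simp add: eq_neg_iff_add_eq_0 flip: mult_2)
    show "root_of_unity (\<alpha> / - \<alpha>)"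
      unfolding root_of_unity_def using \<open>\<alpha> \<noteq> 0\<close> by (intro exI[of _ 2]) simp
  qed
  moreover have "\<bar>coeff [:d, c, b, a:] j\<bar> \<le> int H" for j
    using H by (auto simp: coeff_pCons split: nat.splits)
  ultimately show "[:d, c, b, a:] \<in> degenerate_cubics H"
    using nz by (auto simp: degenerate_cubics_def)
qed

text \<open>An inclusion is enough: overlaps between the kinds, and non-cubics such as those with
  \<open>a = 0\<close> in the middle box, are absorbed by the O(H^2) error.\<close>

lemma degenerate_cubics_upper:
  "degenerate_cubics H \<subseteq> (\<lambda>(a, b, c, d). [:d, c, b, a:]) `
     (proportional_cubics H \<union> {-int H..int H} \<times> {0} \<times> {0} \<times> {-int H..int H} \<union> split_cubics H)"
proof
  fix f assume f: "f \<in> degenerate_cubics H"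
  define a b c d where "a = coeff f 3" and "b = coeff f 2" and "c = coeff f 1" and "d = coeff f 0"
  have f_eq: "f = [:d, c, b, a:]"
    unfolding a_def b_def c_def d_def using f by (intro cubic_coeffs) (simp add: degenerate_cubics_def)
  have H: "\<bar>a\<bar> \<le> int H" "\<bar>b\<bar> \<le> int H" "\<bar>c\<bar> \<le> int H" "\<bar>d\<bar> \<le> int H"
    unfolding a_def b_def c_def d_def using f by (auto simp: degenerate_cubics_def)
  have "a \<noteq> 0" unfolding a_def using f
    by (metis (mono_tags, lifting) degenerate_cubics_def leading_coeff_0_iff degree_0 mem_Collect_eq zero_neq_numeral)
  from f obtain \<alpha> \<beta> where ab: "poly (map_poly of_int f) \<alpha> = 0" "poly (map_poly of_int f) \<beta> = 0"
    "\<alpha> \<noteq> \<beta>" "root_of_unity (\<alpha> / \<beta>)"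
    by (auto simp: degenerate_cubics_def degenerate_def)
  from degenerate_cubic_cases[OF \<open>a \<noteq> 0\<close> ab(3,4) ab(1,2)[unfolded f_eq poly_cubic]]
  have "(a, b, c, d) \<in> proportional_cubics H \<union> {-int H..int H} \<times> {0} \<times> {0} \<times> {-int H..int H} \<union> split_cubics H"
    using H \<open>a \<noteq> 0\<close> by (auto simp: proportional_cubics_def split_cubics_def abs_le_iff)
  then show "f \<in> (\<lambda>(a, b, c, d). [:d, c, b, a:]) `
     (proportional_cubics H \<union> {-int H..int H} \<times> {0} \<times> {0} \<times> {-int H..int H} \<union> split_cubics H)"
    unfolding f_eq by (intro image_eqI[of _ _ "(a, b, c, d)"]) auto
qed

lemma D3_star_approx:
  "\<exists>K. \<forall>H>0. \<bar>real (D3_star H) - 8 * real H ^ 2 * coprime_density_sum H\<bar> \<le> K * real H ^ 2"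
proof -
  define K where "K = 216 * (pi ^ 2 / 6) ^ 3"
  let ?emb = "\<lambda>(a, b, c, d). [:d, c, b, a:] :: int poly"
  \<comment> \<open>45 = 8 * 4 + 4 + 9: rounding in the positive quadruples, the (2 H)^2 cubics with
    b = d = 0, and (2 H + 1)^2 \<le> 9 H^2 for b = c = 0, where H > 0 enters.\<close>
  have "\<bar>real (D3_star H) - 8 * real H ^ 2 * coprime_density_sum H\<bar> \<le> (K + 45) * real H ^ 2" if "H > 0" for H
  proof -
    have approx: "\<bar>real (card (proportional_cubics H)) - 8 * real H ^ 2 * coprime_density_sum H\<bar> \<le> 36 * real H ^ 2"
      using card_proportional_quads_approx[of H] unfolding card_proportional_cubics
      by (simp add: power_mult_distrib abs_le_iff)
    have "card (proportional_cubics H) = card (?emb ` proportional_cubics H)"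
      by (rule card_image[symmetric]) (auto simp: inj_on_def)
    also have "\<dots> \<le> D3_star H"
      unfolding D3_star_def by (intro card_mono finite_degenerate_cubics degenerate_cubics_lower)
    finally have lower: "card (proportional_cubics H) \<le> D3_star H" .
    let ?B = "{-int H..int H} \<times> {0::int} \<times> {0::int} \<times> {-int H..int H}"
    have "D3_star H \<le> card (?emb ` (proportional_cubics H \<union> ?B \<union> split_cubics H))"
      unfolding D3_star_def by (intro card_mono degenerate_cubics_upper) auto
    also have "\<dots> \<le> card (proportional_cubics H \<union> ?B \<union> split_cubics H)" by (intro card_image_le) auto
    also have "\<dots> \<le> card (proportional_cubics H) + card ?B + card (split_cubics H)"
      by (meson add_le_mono1 card_Un_le le_trans)
    finally have "real (D3_star H) \<le> real (card (proportional_cubics H)) + real (card ?B) + real (card (split_cubics H))"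
      by linarith
    moreover have "real (card ?B) \<le> 9 * real H ^ 2"
    proof -
      have "real (card ?B) = (2 * real H + 1) ^ 2" by (simp add: card_cartesian_product power2_eq_square)
      also have "\<dots> \<le> (3 * real H) ^ 2" using that by (intro power_mono) auto
      finally show ?thesis by (simp add: power_mult_distrib)
    qed
    moreover have "real (card (split_cubics H)) \<le> K * real H ^ 2"
      using card_split_cubics_le by (simp add: K_def)
    moreover have "K * real H ^ 2 \<ge> 0" by (simp add: K_def)
    ultimately show ?thesis using approx lower by (simp add: algebra_simps abs_le_iff)
  qed
  then show ?thesis by blast
qed

theorem theorem6p4:
  "(\<lambda>H::nat. real (D3_star H) / (real H ^ 2 * ln (real H))) \<longlonglongrightarrow> 96 / pi ^ 2"
proof -
  obtain K where K: "\<And>H. H > 0 \<Longrightarrow> \<bar>real (D3_star H) - 8 * real H ^ 2 * coprime_density_sum H\<bar> \<le> K * real H ^ 2"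
    using D3_star_approx by blast
  define e where "e = (\<lambda>H::nat. if H = 0 then 0 else real (D3_star H) / real H ^ 2 - 8 * coprime_density_sum H)"
  \<comment> \<open>The sign of \<open>K\<close> is not recorded, and its bound concerns positive
    \<open>H\<close>; the maximum with 0 also covers \<open>e 0 = 0\<close>.\<close>
  have "\<bar>e H\<bar> \<le> max K 0" for H
  proof (cases "H = 0")
    case False
    then have "e H = (real (D3_star H) - 8 * real H ^ 2 * coprime_density_sum H) / real H ^ 2"
      by (simp add: e_def field_simps)
    then show ?thesis using K[of H] False by (simp add: abs_divide divide_le_eq le_max_iff_disj)
  qed (simp add: e_def)
  then have "(\<lambda>H. 8 * (coprime_density_sum H / ln (real H)) + e H / ln (real H)) \<longlonglongrightarrow> 8 * (12 / pi ^ 2) + 0"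
    by (intro tendsto_intros coprime_density_sum_asymptotics bounded_over_ln_tendsto_0)
  moreover have "\<forall>\<^sub>F H in sequentially. 8 * (coprime_density_sum H / ln (real H)) + e H / ln (real H)
      = real (D3_star H) / (real H ^ 2 * ln (real H))"
    using eventually_gt_at_top[of 0] by eventually_elim (simp add: e_def diff_divide_distrib)
  ultimately show ?thesis by (simp add: tendsto_cong)
qed

end
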